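(* Let $\alpha>0$ and let $\{Z_i,i\in\mathbb{Z}\}$ be i.i.d. positive random variables with finite mean $\mu$; set $\psi(t)=\mathbb{P}(Z_i>t)$. Let $a,b:\mathbb{R}_+\to\mathbb{R}_+$ be two nonnegative, nondecreasing functions satisfying $\psi(a(n))\to0$, $\psi(b(n))\to0$ and $n\psi(b(n))\to\infty$ as $n\to\infty$, and such that $$\sum_{n\in\mathbb{N}}\psi(a(n))<\infty,\qquad\sum_{n\in\mathbb{N}}\psi(b(n))\,e^{-n\psi(b(n))}<\infty.$$ Then, for any $\gamma\in(0,1)$, there exists a positive constant $C=C(\gamma)<\infty$ such that $$\frac1C\,\frac{e^{-a(L/(\gamma\mu))^\alpha}}{L}\;\le\;\Phi_L\;\le\;C(\log L)^2\,\frac{e^{-d(\alpha)\,b(\gamma L/\mu)^\alpha}}{L},\qquad\mathbb{P}\text{-a.s.},\tag{$*$}$$ where $d(\alpha)=1$ if $\alpha\ge1$ and $d(\alpha)=3^{\alpha-1}$ if $\alpha<1$. Moreover, if the $Z_i$'s are bounded one can take $a$ and $b$ constant in $( * )$. Finally, if the $Z_i$'s are bounded away from zero then the estimate in the right-hand side of $( * )$ holds without the logarithmic correction (i.e. without the factor $(\log L)^2$).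
   Context: $\xi=\{x_k\}_{k\in\mathbb{Z}}$ is the renewal point process with $x_0=0$, $x_k=x_{k-1}+Z_{k-1}$; $\mathbb{P}$ is its law. For $L>0$: $\Lambda_L=[-L/2,L/2]$, $\xi_L=\xi\cap\Lambda_L$, and $\#(U)$ is the number of points of $U$. Cheeger's isoperimetric constant is $$\Phi_L=\Phi_L(\xi)=\min_{\emptyset\ne U\subset\xi_L:\ \#(U)\le\frac12\#(\xi_L)}I_U(\xi),\qquad I_U(\xi)=\frac1{\#(U)}\sum_{x\in U,\ y\in\xi_L\setminus U}e^{-|x-y|^\alpha}.$$ Here $a(t)^\alpha$ means $(a(t))^\alpha$, and similarly for $b$. "Bounded away from zero" means $\mathbb{P}(Z_i>\varepsilon)=1$ for some $\varepsilon>0$. Convention: an assertion depending on $L$ holds "$\mathbb{P}$-a.s." if with $\mathbb{P}$-probability $1$ there is $L_0=L_0(\xi)<\infty$ such that it holds for all $L\in\mathbb{N}$ with $L\ge L_0$. Constants such as $C$ are deterministic. *)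

theory Defs
  imports "HOL-Probability.Probability"
begin

text \<open>The points \<open>x\<^sub>k\<close> for a two-sided sequence \<open>z\<close> of gaps. The lemmas below show that this is
  the solution of \<open>x\<^sub>0 = 0\<close>, \<open>x\<^sub>k = x\<^sub>k\<^sub>-\<^sub>1 + z\<^sub>k\<^sub>-\<^sub>1\<close> for all integers \<open>k\<close>.\<close>

definition renewal_point :: "(int \<Rightarrow> real) \<Rightarrow> int \<Rightarrow> real" where
  "renewal_point z k = (\<Sum>i\<in>{0..<k}. z i) - (\<Sum>i\<in>{k..<0}. z i)"

lemma renewal_point_0: "renewal_point z 0 = 0"
  by (simp add: renewal_point_def)

lemma renewal_point_step: "renewal_point z k = renewal_point z (k - 1) + z (k - 1)"
proof (cases "k \<ge> 1")
  case True
  then have "{0..<k} = insert (k - 1) {0..<k - 1}" by auto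
  with True show ?thesis by (simp add: renewal_point_def)
next
  case False
  then have "{k - 1..<0} = insert (k - 1) {k..<0}" by auto
  with False show ?thesis by (simp add: renewal_point_def)
qed

definition renewal_process :: "(int \<Rightarrow> real) \<Rightarrow> real set" where
  "renewal_process z = range (renewal_point z)"

definition restrict_box :: "real set \<Rightarrow> real \<Rightarrow> real set" where
  "restrict_box \<xi> L = \<xi> \<inter> {- L / 2..L / 2}"

definition isoperimetric_ratio :: "real \<Rightarrow> real \<Rightarrow> real set \<Rightarrow> real set \<Rightarrow> real" where
  "isoperimetric_ratio \<alpha> L \<xi> U =
     1 / real (card U) * (\<Sum>x\<in>U. \<Sum>y\<in>restrict_box \<xi> L - U. exp (- (\<bar>x - y\<bar> powr \<alpha>)))"

text \<open>The minimum is meaningful when the box contains finitely many, and at least two, points. For a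
  renewal process with positive i.i.d. gaps of finite mean this is almost surely the case for all
  large \<open>L\<close>.\<close>

definition cheeger :: "real \<Rightarrow> real \<Rightarrow> real set \<Rightarrow> real" where
  "cheeger \<alpha> L \<xi> = Min {isoperimetric_ratio \<alpha> L \<xi> U | U.
     U \<noteq> {} \<and> U \<subseteq> restrict_box \<xi> L \<and> real (card U) \<le> 1 / 2 * real (card (restrict_box \<xi> L))}"

definition d_exp :: "real \<Rightarrow> real" where
  "d_exp \<alpha> = (if \<alpha> \<ge> 1 then 1 else 3 powr (\<alpha> - 1))"

definition lower_rate :: "real \<Rightarrow> real \<Rightarrow> real \<Rightarrow> (real \<Rightarrow> real) \<Rightarrow> real \<Rightarrow> real" where
  "lower_rate \<alpha> \<mu> \<gamma> a L = exp (- (a (L / (\<gamma> * \<mu>)) powr \<alpha>)) / L"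

definition upper_rate :: "real \<Rightarrow> real \<Rightarrow> real \<Rightarrow> (real \<Rightarrow> real) \<Rightarrow> real \<Rightarrow> real" where
  "upper_rate \<alpha> \<mu> \<gamma> b L = exp (- d_exp \<alpha> * b (\<gamma> * L / \<mu>) powr \<alpha>) / L"

text \<open>The conditions on \<open>a\<close> and \<open>b\<close> relative to the tail function \<open>\<psi>\<close>. Both functions live on the
  nonnegative half-line; their values at negative arguments are irrelevant.\<close>

definition admissible :: "(real \<Rightarrow> real) \<Rightarrow> (real \<Rightarrow> real) \<Rightarrow> (real \<Rightarrow> real) \<Rightarrow> bool" where
  "admissible \<psi> a b \<longleftrightarrow>
     (\<forall>t\<ge>0. a t \<ge> 0) \<and> (\<forall>t\<ge>0. b t \<ge> 0) \<and> mono_on {0..} a \<and> mono_on {0..} b \<and>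
     (\<lambda>n::nat. \<psi> (a (real n))) \<longlonglongrightarrow> 0 \<and>
     (\<lambda>n::nat. \<psi> (b (real n))) \<longlonglongrightarrow> 0 \<and>
     filterlim (\<lambda>n::nat. real n * \<psi> (b (real n))) at_top sequentially \<and>
     summable (\<lambda>n::nat. \<psi> (a (real n))) \<and>
     summable (\<lambda>n::nat. \<psi> (b (real n)) * exp (- (real n * \<psi> (b (real n)))))"

end

theory Submission
  imports Defs "HOL-Real_Asymp.Real_Asymp"
begin

text \<open>
  The Cheeger constant of a one-dimensional point set is governed by the largest gap inside the box.
  Every competing set is left across some gap, of length \<open>z\<close> say; the endpoints of that gap alone contribute
  \<open>exp (- z^\<alpha>)\<close>, and the set has \<open>O(L)\<close> points. So an upper bound on all gaps in the box is a lower bound on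
  the constant (\<open>cheeger_lower_bound\<close>). Conversely, cutting the box at a long gap separates it into two
  pieces that interact weakly, which bounds the constant from above if both pieces contain a positive
  fraction of the points (\<open>cheeger_upper_bound\<close>).

  To estimate this interaction, note that the distance between points on different sides of the gap is the length of
  the gap plus the distances of the points to its endpoints. The \<open>\<alpha>\<close>-th power of this sum dominates
  \<open>d(\<alpha>)\<close> times the sum of the \<open>\<alpha>\<close>-th powers, so the interaction factorises, and each side contributes a
  convergent sum times the maximal number \<open>m\<close> of points in a unit interval. By an exponential Markov
  inequality and a union bound, \<open>m\<close> is of order \<open>log L\<close>, or constant if the gaps are bounded away from zero; this is where the factor
  \<open>(log L)\<^sup>2\<close> comes from.

  It remains to locate the gaps. The strong law of large numbers says that the indices of the points in
  the box fill an interval of half-length about \<open>L/(2\<mu>)\<close>. Only linear bounds on the partial sums are used,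
  and they follow from the fact that a random walk with negative drift is bounded above
  (\<open>negative_drift_bdd_above\<close>), which has a short proof with Garsia's argument and the 0-1 law.
  That all gaps in the box are at most \<open>a(L/(\<gamma>\<mu>))\<close> is the first Borel-Cantelli lemma. That some gap in the
  middle of the box exceeds \<open>b(\<gamma>L/\<mu>)\<close> would be Klass' theorem on lower bounds for maxima if \<open>\<gamma> = 1\<close>. Since
  \<open>\<gamma> < 1\<close>, it suffices that among the window sizes in \<open>[n, \<theta>n]\<close>, for some \<open>\<theta> > 1\<close>, there is one whose window
  contains a large gap, and this follows from the summability of \<open>P(E\<^sub>n)/n\<close>, where \<open>E\<^sub>n\<close> is the event
  that the window of size \<open>n\<close> has no gap above \<open>b(n)\<close>: a random series with weights \<open>1/n\<close> and finite
  expectation cannot contain whole stretches \<open>[n, \<theta>n]\<close> infinitely often (\<open>large_gap_eventually\<close>).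
\<close>

section \<open>Random walks with negative drift\<close>

text \<open>The maximum of \<open>0\<close> and of the first \<open>n\<close> partial sums of \<open>v\<close>, computed backwards in time. The
  recursion is the point: it shifts \<open>v\<close>, which is harmless for an i.i.d. sequence.\<close>

primrec max_partial_sum :: "nat \<Rightarrow> (nat \<Rightarrow> real) \<Rightarrow> real" where
  "max_partial_sum 0 v = 0"
| "max_partial_sum (Suc n) v = max 0 (v 0 + max_partial_sum n (\<lambda>i. v (Suc i)))"

lemma max_partial_sum_nonneg: "0 \<le> max_partial_sum n v"
  by (cases n) auto

lemma max_partial_sum_mono: "max_partial_sum n v \<le> max_partial_sum (Suc n) v"
proof (induction n arbitrary: v)
  case (Suc n)
  show ?case
    unfolding max_partial_sum.simps(2)[of "Suc n"] max_partial_sum.simps(2)[of n v]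
    using Suc[of "\<lambda>i. v (Suc i)"] by (intro max.mono add_left_mono) auto
qed simp

lemma sum_le_max_partial_sum: "(\<Sum>i<n. v i) \<le> max_partial_sum n v"
proof (induction n arbitrary: v)
  case (Suc n)
  have "(\<Sum>i<Suc n. v i) = v 0 + (\<Sum>i<n. v (Suc i))"
    by (rule sum.lessThan_Suc_shift)
  with Suc[of "\<lambda>i. v (Suc i)"] show ?case by simp
qed simp

lemma measurable_max_partial_sum [measurable]:
  "max_partial_sum n \<in> borel_measurable (PiM UNIV (\<lambda>_::nat. borel))"
proof (induction n)
  case (Suc n)
  have shift: "(\<lambda>v i. v (Suc i)) \<in> measurable (PiM UNIV (\<lambda>_::nat. borel)) (PiM UNIV (\<lambda>_::nat. borel :: real measure))"
    by (rule measurable_PiM_single') auto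
  note [measurable] = Suc measurable_compose[OF shift Suc]
  show ?case unfolding max_partial_sum.simps(2) by measurable
qed simp

context prob_space
begin

lemma indep_vars_inj_reindex:
  assumes indep: "indep_vars (\<lambda>_. N) X UNIV" and f: "inj f"
  shows "indep_vars (\<lambda>_. N) (\<lambda>i. X (f i)) UNIV"
proof -
  have "indep_vars (\<lambda>j. PiM {f j} (\<lambda>_. N)) (\<lambda>j \<omega>. \<lambda>i\<in>{f j}. X i \<omega>) UNIV"
    using f by (intro indep_vars_restrict[OF indep]) (auto simp: disjoint_family_on_def inj_def)
  then have "indep_vars (\<lambda>_. N) (\<lambda>j. (\<lambda>v. v (f j)) \<circ> (\<lambda>\<omega>. \<lambda>i\<in>{f j}. X i \<omega>)) UNIV"
    by (rule indep_vars_compose) (rule measurable_component_singleton, simp)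
  then show ?thesis by (simp add: o_def)
qed

lemma iid_shift_distr:
  fixes X :: "nat \<Rightarrow> 'a \<Rightarrow> real"
  assumes indep: "indep_vars (\<lambda>_. borel) X UNIV"
    and ident: "\<And>i. distr M borel (X i) = distr M borel (X 0)"
  shows "distr M (PiM UNIV (\<lambda>_::nat. borel)) (\<lambda>\<omega> i. X (k + i) \<omega>) = PiM UNIV (\<lambda>_. distr M borel (X 0))"
proof -
  have rv: "random_variable borel (X i)" for i
    using indep by (simp add: indep_vars_def)
  have "indep_vars (\<lambda>_. borel) (\<lambda>i. X (k + i)) UNIV"
    using indep by (rule indep_vars_inj_reindex) simp
  then have "distr M (PiM UNIV (\<lambda>_::nat. borel)) (\<lambda>\<omega>. \<lambda>i\<in>UNIV. X (k + i) \<omega>)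
      = PiM UNIV (\<lambda>i. distr M borel (X (k + i)))"
    by (subst (asm) indep_vars_iff_distr_eq_PiM) (auto simp: rv)
  then show ?thesis
    by (simp add: ident[of "k + _"] restrict_UNIV)
qed

lemma iid_integral_shift:
  fixes X :: "nat \<Rightarrow> 'a \<Rightarrow> real" and f :: "(nat \<Rightarrow> real) \<Rightarrow> real"
  assumes indep: "indep_vars (\<lambda>_. borel) X UNIV"
    and ident: "\<And>i. distr M borel (X i) = distr M borel (X 0)"
    and [measurable]: "f \<in> borel_measurable (PiM UNIV (\<lambda>_::nat. borel))"
  shows "expectation (\<lambda>\<omega>. f (\<lambda>i. X (k + i) \<omega>)) = expectation (\<lambda>\<omega>. f (\<lambda>i. X i \<omega>))"
proof -
  have rv: "random_variable borel (X i)" for i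
    using indep by (simp add: indep_vars_def)
  have m: "(\<lambda>\<omega> i. X (j + i) \<omega>) \<in> measurable M (PiM UNIV (\<lambda>_::nat. borel))" for j
    by (rule measurable_PiM_single') (auto simp: rv)
  have "expectation (\<lambda>\<omega>. f (\<lambda>i. X (j + i) \<omega>)) = integral\<^sup>L (PiM UNIV (\<lambda>_. distr M borel (X 0))) f" for j
    using integral_distr[OF m assms(3), of j] iid_shift_distr[OF indep ident, of j] by simp
  from this[of k] this[of 0] show ?thesis by simp
qed

text \<open>Whether the partial sums are bounded does not depend on finitely many terms, so Kolmogorov's
  law applies.\<close>

lemma partial_sums_unbounded_0_1:
  fixes X :: "nat \<Rightarrow> 'a \<Rightarrow> real"
  assumes indep: "indep_vars (\<lambda>_. borel) X UNIV"
  shows "prob {\<omega>\<in>space M. \<not> bdd_above (range (\<lambda>n. \<Sum>i<n. X i \<omega>))} \<in> {0, 1}"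
proof -
  let ?A = "{\<omega>\<in>space M. \<not> bdd_above (range (\<lambda>n. \<Sum>i<n. X i \<omega>))}"
  let ?G = "\<lambda>i. {X i -` B \<inter> space M | B. B \<in> sets borel}"
  let ?F = "\<lambda>i. sigma_sets (space M) (?G i)"
  have sub: "?G i \<subseteq> Pow (space M)" for i by auto
  have "prob ?A = 0 \<or> prob ?A = 1"
  proof (rule kolmogorov_0_1_law)
    show "sigma_algebra (space M) (?F i)" for i
      using sub by (rule sigma_algebra_sigma_sets)
    show "indep_sets ?F UNIV"
      using indep by (simp add: indep_vars_def)
    show "?A \<in> tail_events ?F"
      unfolding tail_events_def
    proof
      fix n :: nat
      define N where "N = sigma (space M) (\<Union>(?F ` {n..}))"
      have subN: "\<Union>(?F ` {n..}) \<subseteq> Pow (space M)"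
        using sigma_sets_into_sp[OF sub] by fastforce
      have sN: "space N = space M" "sets N = sigma_sets (space M) (\<Union>(?F ` {n..}))"
        using subN by (simp_all add: N_def)
      have X [measurable]: "X (n + i) \<in> borel_measurable N" for i
      proof (rule measurableI)
        fix B :: "real set" assume "B \<in> sets borel"
        then have "X (n + i) -` B \<inter> space M \<in> ?F (n + i)"
          by (intro sigma_sets.Basic) auto
        then show "X (n + i) -` B \<inter> space N \<in> sets N"
          unfolding sN by (intro sigma_sets.Basic) auto
      qed simp
      have "bdd_above (range (\<lambda>j. \<Sum>i<j. X i \<omega>)) \<longleftrightarrow> (\<exists>B::nat. \<forall>j. (\<Sum>i<j. X (n + i) \<omega>) \<le> real B)" for \<omega>
      proof -
        have split: "(\<Sum>i<n + j. X i \<omega>) = (\<Sum>i<n. X i \<omega>) + (\<Sum>i<j. X (n + i) \<omega>)" for j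
          by (induction j) (simp_all add: add.assoc)
        show ?thesis
        proof
          assume "bdd_above (range (\<lambda>j. \<Sum>i<j. X i \<omega>))"
          then obtain B where B: "\<And>j. (\<Sum>i<j. X i \<omega>) \<le> B"
            by (auto simp: bdd_above_def)
          have "(\<Sum>i<j. X (n + i) \<omega>) \<le> real (nat \<lceil>B - (\<Sum>i<n. X i \<omega>)\<rceil>)" for j
            using B[of "n + j"] split[of j] by linarith
          then show "\<exists>B::nat. \<forall>j. (\<Sum>i<j. X (n + i) \<omega>) \<le> real B" by blast
        next
          assume "\<exists>B::nat. \<forall>j. (\<Sum>i<j. X (n + i) \<omega>) \<le> real B"
          then obtain B :: nat where B: "\<And>j. (\<Sum>i<j. X (n + i) \<omega>) \<le> real B" by blast
          let ?m = "Max ((\<lambda>j. \<Sum>i<j. X i \<omega>) ` {..n})"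
          have "(\<Sum>i<j. X i \<omega>) \<le> ?m + real B" for j
          proof (cases "j \<le> n")
            case True
            then have "(\<Sum>i<j. X i \<omega>) \<le> ?m"
              by (intro Max_ge) auto
            then show ?thesis by simp
          next
            case False
            have "(\<Sum>i<n. X i \<omega>) \<le> ?m"
              by (intro Max_ge) auto
            moreover have "(\<Sum>i<j. X i \<omega>) = (\<Sum>i<n. X i \<omega>) + (\<Sum>i<j - n. X (n + i) \<omega>)"
              using split[of "j - n"] False by simp
            ultimately show ?thesis using B[of "j - n"] by linarith
          qed
          then show "bdd_above (range (\<lambda>j. \<Sum>i<j. X i \<omega>))" by (auto simp: bdd_above_def)
        qed
      qed
      then have "?A = {\<omega>\<in>space N. \<not> (\<exists>B::nat. \<forall>j. (\<Sum>i<j. X (n + i) \<omega>) \<le> real B)}"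
        by (simp add: sN)
      also have "\<dots> \<in> sets N" by measurable
      finally show "?A \<in> sigma_sets (space M) (\<Union>(?F ` {n..}))" by (simp add: sN)
    qed
  qed
  then show ?thesis by simp
qed

text \<open>Write \<open>T\<close> for the running maximum and \<open>T'\<close> for that of the shifted sequence. Then
  \<open>T (n + 1) - T' n = max (- T' n) (X 0)\<close>, and the left-hand side has nonnegative expectation because
  \<open>T' n\<close> and \<open>T n\<close> are equally distributed. If the partial sums were almost surely unbounded, then \<open>T'\<close> would tend to
  infinity, and the right-hand side to \<open>X 0\<close>, which has negative mean.\<close>

theorem negative_drift_bdd_above:
  fixes X :: "nat \<Rightarrow> 'a \<Rightarrow> real"
  assumes indep: "indep_vars (\<lambda>_. borel) X UNIV"
    and ident: "\<And>i. distr M borel (X i) = distr M borel (X 0)"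
    and int0: "integrable M (X 0)" and neg: "expectation (X 0) < 0"
  shows "AE \<omega> in M. bdd_above (range (\<lambda>n. \<Sum>i<n. X i \<omega>))"
proof -
  let ?A = "{\<omega>\<in>space M. \<not> bdd_above (range (\<lambda>n. \<Sum>i<n. X i \<omega>))}"
  have rv [measurable]: "random_variable borel (X i)" for i
    using indep by (simp add: indep_vars_def)
  have int: "integrable M (X i)" for i
  proof -
    have "integrable (distr M borel (X 0)) (\<lambda>x. x)"
      using int0 by (subst integrable_distr_eq) auto
    then have "integrable (distr M borel (X i)) (\<lambda>x. x)" by (simp add: ident[of i])
    then show ?thesis by (subst (asm) integrable_distr_eq) auto
  qed
  define T where "T n k \<omega> = max_partial_sum n (\<lambda>i. X (k + i) \<omega>)" for n k \<omega>
  have T_Suc: "T (Suc n) k \<omega> = max 0 (X k \<omega> + T n (Suc k) \<omega>)" for n k \<omega>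
    by (simp add: T_def)
  have T_int: "integrable M (T n k)" for n k
  proof (induction n arbitrary: k)
    case 0
    then show ?case by (simp add: T_def[abs_def])
  next
    case (Suc n)
    have eq: "T (Suc n) k = (\<lambda>\<omega>. max 0 (X k \<omega> + T n (Suc k) \<omega>))" by (rule ext) (rule T_Suc)
    show ?case unfolding eq using Suc[of "Suc k"] int[of k] by (intro integrable_max) auto
  qed
  have T_meas [measurable]: "random_variable borel (T n k)" for n k
    using T_int[of n k] by (rule borel_measurable_integrable)
  have T_nonneg: "0 \<le> T n k \<omega>" for n k \<omega>
    by (simp add: T_def max_partial_sum_nonneg)
  have nonneg: "0 \<le> expectation (\<lambda>\<omega>. max (- T n 1 \<omega>) (X 0 \<omega>))" for n
  proof -
    have "expectation (T n 1) = expectation (T n 0)"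
      unfolding T_def[abs_def] using iid_integral_shift[OF indep ident measurable_max_partial_sum, of n 1] by simp
    also have "\<dots> \<le> expectation (T (Suc n) 0)"
      by (rule integral_mono[OF T_int T_int]) (simp add: T_def max_partial_sum_mono del: max_partial_sum.simps)
    finally have "0 \<le> expectation (\<lambda>\<omega>. T (Suc n) 0 \<omega> - T n 1 \<omega>)"
      by (simp add: T_int)
    also have "(\<lambda>\<omega>. T (Suc n) 0 \<omega> - T n 1 \<omega>) = (\<lambda>\<omega>. max (- T n 1 \<omega>) (X 0 \<omega>))"
      by (auto simp: T_Suc)
    finally show ?thesis .
  qed
  have A_meas: "?A \<in> events"
  proof -
    have "bdd_above (range (\<lambda>n. \<Sum>i<n. X i \<omega>)) \<longleftrightarrow> (\<exists>B::nat. \<forall>j. (\<Sum>i<j. X i \<omega>) \<le> real B)" for \<omega>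
      unfolding bdd_above_def by (auto intro: order.trans) (meson order.trans real_arch_simple)
    then have "?A = {\<omega>\<in>space M. \<not> (\<exists>B::nat. \<forall>j. (\<Sum>i<j. X i \<omega>) \<le> real B)}" by simp
    also have "\<dots> \<in> events" by measurable
    finally show ?thesis .
  qed
  have "prob ?A \<noteq> 1"
  proof
    assume "prob ?A = 1"
    then have ae: "AE \<omega> in M. \<omega> \<in> ?A"
      using A_meas prob_eq_1 by blast
    have "(\<lambda>n. expectation (\<lambda>\<omega>. max (- T n 1 \<omega>) (X 0 \<omega>))) \<longlonglongrightarrow> expectation (X 0)"
    proof (rule integral_dominated_convergence[where w = "\<lambda>\<omega>. \<bar>X 0 \<omega>\<bar>"])
      show "AE \<omega> in M. (\<lambda>n. max (- T n 1 \<omega>) (X 0 \<omega>)) \<longlonglongrightarrow> X 0 \<omega>"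
        using ae
      proof eventually_elim
        case (elim \<omega>)
        have "\<exists>m. - X 0 \<omega> \<le> T m 1 \<omega>"
        proof (rule ccontr)
          assume "\<nexists>m. - X 0 \<omega> \<le> T m 1 \<omega>"
          then have small: "T m 1 \<omega> < - X 0 \<omega>" for m by (simp add: not_le)
          have "(\<Sum>i<n. X i \<omega>) \<le> 0" for n
          proof (cases n)
            case (Suc m)
            have "(\<Sum>i<Suc m. X i \<omega>) = X 0 \<omega> + (\<Sum>i<m. X (1 + i) \<omega>)"
              using sum.lessThan_Suc_shift[of "\<lambda>i. X i \<omega>" m] by simp
            also have "\<dots> \<le> X 0 \<omega> + T m 1 \<omega>"
              unfolding T_def by (intro add_left_mono sum_le_max_partial_sum)
            finally show ?thesis using small[of m] Suc by simp
          qed simp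
          then have "bdd_above (range (\<lambda>n. \<Sum>i<n. X i \<omega>))" by (auto simp: bdd_above_def)
          with elim show False by simp
        qed
        then obtain m where m: "- X 0 \<omega> \<le> T m 1 \<omega>" ..
        have "incseq (\<lambda>n. T n 1 \<omega>)"
          by (rule incseq_SucI) (simp add: T_def max_partial_sum_mono del: max_partial_sum.simps)
        then have "max (- T n 1 \<omega>) (X 0 \<omega>) = X 0 \<omega>" if "n \<ge> m" for n
          using incseqD[OF _ that] m by fastforce
        then show ?case
          by (intro tendsto_eventually eventually_sequentiallyI[of m]) auto
      qed
      show "AE \<omega> in M. norm (max (- T n 1 \<omega>) (X 0 \<omega>)) \<le> \<bar>X 0 \<omega>\<bar>" for n
      proof (rule AE_I2)
        fix \<omega>
        show "norm (max (- T n 1 \<omega>) (X 0 \<omega>)) \<le> \<bar>X 0 \<omega>\<bar>"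
          using T_nonneg[of n 1 \<omega>] by (cases "- T n 1 \<omega> \<le> X 0 \<omega>") (auto simp: max_def)
      qed
    qed (use int in auto)
    then have "0 \<le> expectation (X 0)"
      by (rule LIMSEQ_le_const) (use nonneg in auto)
    with neg show False by simp
  qed
  then have "prob ?A = 0"
    using partial_sums_unbounded_0_1[OF indep] by simp
  then show ?thesis
    using A_meas by (intro AE_I[of _ _ ?A]) (auto simp: emeasure_eq_measure)
qed

end

section \<open>Points in a box and the Cheeger constant\<close>

definition box_indices :: "(int \<Rightarrow> real) \<Rightarrow> real \<Rightarrow> int set" where
  "box_indices z L = {k. \<bar>renewal_point z k\<bar> \<le> L / 2}"

lemma restrict_box_renewal:
  "restrict_box (renewal_process z) L = renewal_point z ` box_indices z L"
  by (auto simp: restrict_box_def renewal_process_def box_indices_def abs_le_iff)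

lemma renewal_point_add:
  "renewal_point z (k + int n) = renewal_point z k + (\<Sum>t<n. z (k + int t))"
proof (induction n)
  case (Suc n)
  have "renewal_point z (k + int (Suc n)) = renewal_point z (k + int n) + z (k + int n)"
    using renewal_point_step[of z "k + int (Suc n)"] by (simp add: algebra_simps)
  with Suc show ?case by simp
qed simp

lemma renewal_point_strict_mono:
  assumes "\<And>i. z i > 0"
  shows "strict_mono (renewal_point z)"
proof (rule strict_monoI)
  fix i j :: int assume "i < j"
  then have j: "j = i + int (nat (j - i))" and "nat (j - i) > 0" by auto
  then have "0 < (\<Sum>t<nat (j - i). z (i + int t))"
    by (intro sum_pos) (auto simp: assms lessThan_empty_iff)
  then show "renewal_point z i < renewal_point z j"
    by (subst j, subst renewal_point_add) simp
qed

lemma renewal_point_inj_on: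
  assumes "\<And>i. z i > 0"
  shows "inj_on (renewal_point z) A"
  using renewal_point_strict_mono[of z, OF assms] by (metis injD inj_onI strict_mono_imp_inj_on)

lemma box_indices_convex:
  assumes pos: "\<And>i. z i > 0" and "k \<in> box_indices z L" "r \<in> box_indices z L" "k \<le> l" "l \<le> r"
  shows "l \<in> box_indices z L"
proof -
  have "renewal_point z k \<le> renewal_point z l" "renewal_point z l \<le> renewal_point z r"
    using assms strict_mono_less_eq[OF renewal_point_strict_mono[of z, OF pos]] by auto
  with assms(2,3) show ?thesis by (auto simp: box_indices_def)
qed

lemma isoperimetric_ratio_indices:
  assumes pos: "\<And>i. z i > 0" and K: "K \<subseteq> box_indices z L"
  shows "isoperimetric_ratio \<alpha> L (renewal_process z) (renewal_point z ` K) =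
    (\<Sum>j\<in>K. \<Sum>k\<in>box_indices z L - K. exp (- (\<bar>renewal_point z j - renewal_point z k\<bar> powr \<alpha>))) / real (card K)"
proof -
  note inj = renewal_point_inj_on[of z, OF pos]
  have diff: "renewal_point z ` box_indices z L - renewal_point z ` K = renewal_point z ` (box_indices z L - K)"
    by (rule inj_on_image_set_diff[symmetric, OF inj[of UNIV]]) auto
  show ?thesis
    by (simp add: isoperimetric_ratio_def restrict_box_renewal diff sum.reindex[OF inj] card_image[OF inj])
qed

lemma cheeger_candidates:
  assumes pos: "\<And>i. z i > 0"
  shows "{isoperimetric_ratio \<alpha> L (renewal_process z) U | U. U \<noteq> {} \<and> U \<subseteq> restrict_box (renewal_process z) L \<and>
      real (card U) \<le> 1 / 2 * real (card (restrict_box (renewal_process z) L))}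
    = (\<lambda>K. isoperimetric_ratio \<alpha> L (renewal_process z) (renewal_point z ` K)) `
       {K. K \<noteq> {} \<and> K \<subseteq> box_indices z L \<and> 2 * card K \<le> card (box_indices z L)}"
  (is "?L = ?f ` ?R")
proof -
  note inj = renewal_point_inj_on[of z, OF pos]
  show ?thesis
  proof (intro equalityI subsetI)
    fix r assume "r \<in> ?L"
    then obtain U where U: "r = isoperimetric_ratio \<alpha> L (renewal_process z) U" "U \<noteq> {}"
      "U \<subseteq> renewal_point z ` box_indices z L"
      "real (card U) \<le> 1 / 2 * real (card (restrict_box (renewal_process z) L))"
      unfolding restrict_box_renewal by blast
    then obtain K where K: "K \<subseteq> box_indices z L" "U = renewal_point z ` K"
      by (meson subset_imageE)
    from U(4) have "2 * card K \<le> card (box_indices z L)"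
      by (simp add: K restrict_box_renewal card_image[OF inj])
    with U(2) K have "K \<in> ?R" by auto
    then show "r \<in> ?f ` ?R" using U(1) K(2) by blast
  next
    fix r assume "r \<in> ?f ` ?R"
    then obtain K where "r = ?f K" "K \<noteq> {}" "K \<subseteq> box_indices z L" "2 * card K \<le> card (box_indices z L)"
      by blast
    then show "r \<in> ?L"
      by (auto simp: restrict_box_renewal card_image[OF inj] intro!: exI[of _ "renewal_point z ` K"])
  qed
qed

lemma cheeger_le_ratio:
  assumes pos: "\<And>i. z i > 0" and fin: "finite (box_indices z L)"
    and K: "K \<noteq> {}" "K \<subseteq> box_indices z L" "2 * card K \<le> card (box_indices z L)"
  shows "cheeger \<alpha> L (renewal_process z) \<le>
    (\<Sum>j\<in>K. \<Sum>k\<in>box_indices z L - K. exp (- (\<bar>renewal_point z j - renewal_point z k\<bar> powr \<alpha>))) / real (card K)"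
  unfolding cheeger_def cheeger_candidates[of z, OF pos] isoperimetric_ratio_indices[of z, OF pos K(2), symmetric]
  using K fin by (intro Min_le finite_imageI) auto

lemma cheeger_geI:
  assumes pos: "\<And>i. z i > 0" and fin: "finite (box_indices z L)" and card: "2 \<le> card (box_indices z L)"
    and ge: "\<And>K. K \<noteq> {} \<Longrightarrow> K \<subseteq> box_indices z L \<Longrightarrow> 2 * card K \<le> card (box_indices z L) \<Longrightarrow>
      c \<le> (\<Sum>j\<in>K. \<Sum>k\<in>box_indices z L - K. exp (- (\<bar>renewal_point z j - renewal_point z k\<bar> powr \<alpha>))) / real (card K)"
  shows "c \<le> cheeger \<alpha> L (renewal_process z)"
proof -
  let ?R = "{K. K \<noteq> {} \<and> K \<subseteq> box_indices z L \<and> 2 * card K \<le> card (box_indices z L)}"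
  from card obtain k where "k \<in> box_indices z L" by fastforce
  with card have "{k} \<in> ?R" by auto
  then have ne: "?R \<noteq> {}" by blast
  have "finite ?R" using fin by auto
  then show ?thesis
    unfolding cheeger_def cheeger_candidates[of z, OF pos]
    using ne by (subst Min_ge_iff) (auto simp: isoperimetric_ratio_indices[of z, OF pos] intro!: ge)
qed

lemma int_switch:
  fixes p q :: int
  assumes "p < q" "P p" "\<not> P q"
  shows "\<exists>k. p \<le> k \<and> k < q \<and> P k \<and> \<not> P (k + 1)"
proof (rule ccontr)
  assume c: "\<nexists>k. p \<le> k \<and> k < q \<and> P k \<and> \<not> P (k + 1)"
  have "p + int n \<le> q \<Longrightarrow> P (p + int n)" for n
  proof (induction n)
    case (Suc n)
    then have "P (p + int n)" by simp
    with c Suc.prems have "P (p + int n + 1)" by force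
    then show ?case by (simp add: algebra_simps)
  qed (use assms in simp)
  from this[of "nat (q - p)"] assms show False by simp
qed

text \<open>A set \<open>U\<close> that is neither empty nor the whole box is left at one of its boundary gaps, and that
  single pair already contributes enough.\<close>

theorem cheeger_lower_bound:
  assumes pos: "\<And>i. z i > 0" and \<alpha>: "0 \<le> \<alpha>"
    and fin: "finite (box_indices z L)" and card: "2 \<le> card (box_indices z L)"
    and gap: "\<And>k. k \<in> box_indices z L \<Longrightarrow> k + 1 \<in> box_indices z L \<Longrightarrow> z k \<le> A"
  shows "2 / real (card (box_indices z L)) * exp (- (A powr \<alpha>)) \<le> cheeger \<alpha> L (renewal_process z)"
proof (rule cheeger_geI[of z, OF pos fin card])
  let ?J = "box_indices z L"
  let ?e = "\<lambda>j k. exp (- (\<bar>renewal_point z j - renewal_point z k\<bar> powr \<alpha>))"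
  fix K assume K: "K \<noteq> {}" "K \<subseteq> ?J" "2 * card K \<le> card ?J"
  have finK: "finite K" using K(2) fin by (rule finite_subset)
  have cK: "card K > 0" using K(1) finK by (simp add: card_gt_0_iff)
  obtain p where p: "p \<in> K" using K(1) by blast
  have "K \<noteq> ?J" using K(3) cK by auto
  then obtain q where q: "q \<in> ?J" "q \<notin> K" using K(2) by blast
  have "\<exists>k. k \<in> ?J \<and> k + 1 \<in> ?J \<and> (k \<in> K) \<noteq> (k + 1 \<in> K)"
  proof (cases "p < q")
    case True
    from int_switch[of p q "\<lambda>k. k \<in> K", OF True] p q obtain k
      where "p \<le> k" "k < q" "k \<in> K" "k + 1 \<notin> K" by blast
    then show ?thesis
      using box_indices_convex[of z p L q, OF pos] p q K(2) by (intro exI[of _ k]) auto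
  next
    case False
    then have "q < p" using p q by (metis linorder_neqE)
    from int_switch[of q p "\<lambda>k. k \<notin> K", OF this] p q obtain k
      where "q \<le> k" "k < p" "k \<notin> K" "k + 1 \<in> K" by blast
    then show ?thesis
      using box_indices_convex[of z q L p, OF pos] p q K(2) by (intro exI[of _ k]) auto
  qed
  then obtain k where k: "k \<in> ?J" "k + 1 \<in> ?J" "(k \<in> K) \<noteq> (k + 1 \<in> K)" by blast
  have dist: "renewal_point z (k + 1) - renewal_point z k = z k"
    using renewal_point_step[of z "k + 1"] by simp
  have "exp (- (A powr \<alpha>)) \<le> exp (- (z k powr \<alpha>))"
    using gap[OF k(1,2)] pos[of k] \<alpha> by (simp add: powr_mono2)
  also have "\<dots> \<le> (\<Sum>j\<in>K. \<Sum>k\<in>?J - K. ?e j k)"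
  proof -
    obtain a b where ab: "a \<in> K" "b \<in> ?J - K" "\<bar>renewal_point z a - renewal_point z b\<bar> = z k"
      using k dist pos[of k] by (cases "k \<in> K") force+
    then have "exp (- (z k powr \<alpha>)) = ?e a b" by simp
    also have "\<dots> \<le> (\<Sum>k\<in>?J - K. ?e a k)"
      using ab fin by (intro member_le_sum) auto
    also have "\<dots> \<le> (\<Sum>j\<in>K. \<Sum>k\<in>?J - K. ?e j k)"
      using ab finK by (intro member_le_sum sum_nonneg) auto
    finally show ?thesis .
  qed
  finally have le: "exp (- (A powr \<alpha>)) \<le> (\<Sum>j\<in>K. \<Sum>k\<in>?J - K. ?e j k)" .
  have "2 / real (card ?J) * exp (- (A powr \<alpha>)) \<le> 1 / real (card K) * exp (- (A powr \<alpha>))"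
    using K(3) cK by (intro mult_right_mono) (auto simp: field_simps)
  also have "\<dots> \<le> 1 / real (card K) * (\<Sum>j\<in>K. \<Sum>k\<in>?J - K. ?e j k)"
    using le by (intro mult_left_mono) auto
  finally show "2 / real (card ?J) * exp (- (A powr \<alpha>)) \<le> (\<Sum>j\<in>K. \<Sum>k\<in>?J - K. ?e j k) / real (card K)"
    by simp
qed

lemma d_exp_pos: "d_exp \<alpha> > 0"
  by (simp add: d_exp_def)

text \<open>For \<open>\<alpha> \<ge> 1\<close> this is superadditivity of the power function, otherwise Jensen's inequality for
  the three equally weighted summands; the latter is read off from the tangent at their mean.\<close>

lemma powr_sum3_ge:
  assumes \<alpha>: "\<alpha> > 0" and nn: "0 \<le> u" "0 \<le> v" "0 \<le> w"
  shows "d_exp \<alpha> * (u powr \<alpha> + v powr \<alpha> + w powr \<alpha>) \<le> (u + v + w) powr \<alpha>"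
proof (cases "\<alpha> \<ge> 1")
  case True
  let ?s = "u + v + w"
  have split: "t powr \<alpha> = t * t powr (\<alpha> - 1)" if "0 \<le> t" for t :: real
    using that powr_add[of t 1 "\<alpha> - 1"] by (cases "t = 0") auto
  have "t powr \<alpha> \<le> t * ?s powr (\<alpha> - 1)" if "0 \<le> t" "t \<le> ?s" for t
    unfolding split[OF that(1)] using that True by (intro mult_left_mono powr_mono2) auto
  from this[of u] this[of v] this[of w] nn
  have "u powr \<alpha> + v powr \<alpha> + w powr \<alpha> \<le> ?s * ?s powr (\<alpha> - 1)"
    by (simp add: algebra_simps)
  also have "\<dots> = ?s powr \<alpha>" using nn by (subst split) auto
  finally show ?thesis using True by (simp add: d_exp_def)
next
  case False
  let ?s = "u + v + w"
  show ?thesis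
  proof (cases "?s = 0")
    case True
    with nn have "u = 0" "v = 0" "w = 0" by auto
    then show ?thesis by simp
  next
    case s: False
    with nn have s: "?s > 0" by simp
    have young: "t powr \<alpha> * (?s / 3) powr (1 - \<alpha>) \<le> \<alpha> * t + (1 - \<alpha>) * (?s / 3)" if "0 \<le> t" for t
    proof (cases "t = 0")
      case True
      then show ?thesis using False s by simp
    next
      case t: False
      with that Youngs_inequality_0[of \<alpha> "1 - \<alpha>" t "?s / 3"] False \<alpha> s
      show ?thesis by simp
    qed
    have "(u powr \<alpha> + v powr \<alpha> + w powr \<alpha>) * (?s / 3) powr (1 - \<alpha>)
        \<le> \<alpha> * u + \<alpha> * v + \<alpha> * w + 3 * ((1 - \<alpha>) * (?s / 3))"
      unfolding distrib_right using young[of u] young[of v] young[of w] nn by linarith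
    also have "\<dots> = ?s" by (simp add: field_simps)
    also have "\<dots> = ?s powr \<alpha> * ?s powr (1 - \<alpha>)"
      using s by (simp add: powr_add[symmetric])
    finally have "(u powr \<alpha> + v powr \<alpha> + w powr \<alpha>) * (?s / 3) powr (1 - \<alpha>) \<le> ?s powr \<alpha> * ?s powr (1 - \<alpha>)" .
    moreover have "(?s / 3) powr (1 - \<alpha>) = d_exp \<alpha> * ?s powr (1 - \<alpha>)"
      using False s powr_minus_divide[of 3 "1 - \<alpha>"] by (simp add: d_exp_def powr_divide)
    ultimately have "(d_exp \<alpha> * (u powr \<alpha> + v powr \<alpha> + w powr \<alpha>)) * ?s powr (1 - \<alpha>) \<le> ?s powr \<alpha> * ?s powr (1 - \<alpha>)"
      by (simp add: mult_ac)
    then show ?thesis using s by (simp add: mult_le_cancel_right)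
  qed
qed

definition interaction_sum :: "real \<Rightarrow> real" where
  "interaction_sum \<alpha> = (\<Sum>q. exp (- (d_exp \<alpha> * real q powr \<alpha>)))"

lemma summable_interaction:
  assumes "\<alpha> > 0"
  shows "summable (\<lambda>q::nat. exp (- (d_exp \<alpha> * real q powr \<alpha>)))"
proof (rule summable_comparison_test_bigo)
  show "summable (\<lambda>q::nat. norm (1 / real q ^ 2))"
    using inverse_power_summable[of 2, where 'a = real] by (simp add: inverse_eq_divide)
  show "(\<lambda>q::nat. exp (- (d_exp \<alpha> * real q powr \<alpha>))) \<in> O(\<lambda>q. 1 / real q ^ 2)"
    using assms d_exp_pos[of \<alpha>] by real_asymp
qed

lemma interaction_sum_pos:
  assumes "\<alpha> > 0"
  shows "interaction_sum \<alpha> > 0"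
  unfolding interaction_sum_def using summable_interaction[OF assms] by (rule suminf_pos) simp

text \<open>For points numbered by increasing distance \<open>v t\<close>, the hypothesis on \<open>v\<close> expresses that unit intervals
  contain at most about \<open>m\<close> of them; each block of \<open>m\<close> points then costs one term of the series.\<close>

lemma sum_exp_spread_le:
  assumes \<alpha>: "\<alpha> > 0" and m: "m \<ge> 1" and T: "finite T"
    and v: "\<And>t. t \<in> T \<Longrightarrow> real (t div m) \<le> v t"
  shows "(\<Sum>t\<in>T. exp (- (d_exp \<alpha> * v t powr \<alpha>))) \<le> real m * interaction_sum \<alpha>"
proof -
  let ?g = "\<lambda>q::nat. exp (- (d_exp \<alpha> * real q powr \<alpha>))"
  obtain N where N: "T \<subseteq> {..<N}" using T finite_nat_bounded by blast
  have "N \<le> N * m" using m by simp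
  then have NN: "{..<N} \<subseteq> {..<N * m}" by (simp only: lessThan_subset_iff)
  have "(\<Sum>t\<in>T. exp (- (d_exp \<alpha> * v t powr \<alpha>))) \<le> (\<Sum>t\<in>T. ?g (t div m))"
    using v \<alpha> d_exp_pos[of \<alpha>] by (intro sum_mono) (simp add: mult_left_mono powr_mono2)
  also have "\<dots> \<le> (\<Sum>t<N * m. ?g (t div m))"
    using order.trans[OF N NN] by (intro sum_mono2) simp_all
  also have "\<dots> = (\<Sum>q<N. \<Sum>t\<in>{q * m..<q * m + m}. ?g (t div m))"
    by (rule sum.nat_group[symmetric])
  also have "\<dots> = (\<Sum>q<N. \<Sum>t\<in>{q * m..<q * m + m}. ?g q)"
  proof (intro sum.cong refl)
    fix q t assume "t \<in> {q * m..<q * m + m}"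
    then have "t div m = q" by (intro div_nat_eqI) (auto simp: mult.commute)
    then show "?g (t div m) = ?g q" by simp
  qed
  also have "\<dots> = real m * (\<Sum>q<N. ?g q)" by (simp add: sum_distrib_left)
  also have "\<dots> \<le> real m * interaction_sum \<alpha>"
    unfolding interaction_sum_def using summable_interaction[OF \<alpha>]
    by (intro mult_left_mono sum_le_suminf) auto
  finally show ?thesis .
qed

lemma renewal_point_spread:
  assumes pos: "\<And>i. z i > 0" and m: "m \<ge> 1"
    and spread: "\<And>k. k \<in> box_indices z L \<Longrightarrow> k + int m \<in> box_indices z L \<Longrightarrow>
      1 \<le> renewal_point z (k + int m) - renewal_point z k"
    and k: "k \<in> box_indices z L" "k + int n \<in> box_indices z L"
  shows "real (n div m) \<le> renewal_point z (k + int n) - renewal_point z k"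
proof -
  have mono: "renewal_point z i \<le> renewal_point z j" if "i \<le> j" for i j
    using that strict_mono_less_eq[OF renewal_point_strict_mono[of z, OF pos]] by auto
  have "q * m \<le> n \<Longrightarrow> real q \<le> renewal_point z (k + int (q * m)) - renewal_point z k" for q
  proof (induction q)
    case (Suc q)
    then have le: "q * m + m \<le> n" by (simp add: add.commute)
    have in1: "k + int (q * m) \<in> box_indices z L"
      by (rule box_indices_convex[of z k L "k + int n", OF pos k])
         (use le in \<open>simp_all flip: of_nat_mult\<close>)
    have in2: "k + int (q * m) + int m \<in> box_indices z L"
      by (rule box_indices_convex[of z k L "k + int n", OF pos k])
         (use le in \<open>simp_all add: add.assoc flip: of_nat_mult of_nat_add\<close>)
    have "1 \<le> renewal_point z (k + int (q * m) + int m) - renewal_point z (k + int (q * m))"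
      using spread[OF in1 in2] .
    moreover have "real q \<le> renewal_point z (k + int (q * m)) - renewal_point z k"
      using Suc.IH le by simp
    moreover have "k + int (q * m) + int m = k + int (Suc q * m)" by (simp add: algebra_simps)
    ultimately show ?case by (simp del: of_nat_mult mult_Suc)
  qed simp
  from this[of "n div m"] have "real (n div m) \<le> renewal_point z (k + int (n div m * m)) - renewal_point z k"
    by simp
  also have "\<dots> \<le> renewal_point z (k + int n) - renewal_point z k"
    by (intro diff_right_mono mono) (simp flip: of_nat_mult)
  finally show ?thesis .
qed

text \<open>Cut the box at a gap of length at least \<open>\<beta>\<close>. The distance between points on different sides is
  this length plus their distances to the endpoints of the gap, and by the inequality for the power of a
  sum of three terms the interaction splits into a product: the gap gives the exponential, either side a convergent sum.\<close>

theorem cheeger_upper_bound: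
  assumes pos: "\<And>i. z i > 0" and \<alpha>: "\<alpha> > 0" and fin: "finite (box_indices z L)" and m: "m \<ge> 1"
    and spread: "\<And>k. k \<in> box_indices z L \<Longrightarrow> k + int m \<in> box_indices z L \<Longrightarrow>
      1 \<le> renewal_point z (k + int m) - renewal_point z k"
    and \<beta>: "0 \<le> \<beta>" "\<beta> \<le> z i"
    and s: "0 < s" "s \<le> real (card {k\<in>box_indices z L. k \<le> i})" "s \<le> real (card {k\<in>box_indices z L. i < k})"
  shows "cheeger \<alpha> L (renewal_process z) \<le>
    (real m * interaction_sum \<alpha>)\<^sup>2 * exp (- (d_exp \<alpha> * \<beta> powr \<alpha>)) / s"
proof -
  let ?J = "box_indices z L"
  let ?x = "renewal_point z"
  let ?d = "d_exp \<alpha>"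
  let ?S = "interaction_sum \<alpha>"
  define A where "A = {k\<in>?J. k \<le> i}"
  define B where "B = {k\<in>?J. i < k}"
  have finAB: "finite A" "finite B" using fin by (auto simp: A_def B_def)
  have cA: "s \<le> real (card A)" and cB: "s \<le> real (card B)" using s by (auto simp: A_def B_def)
  have ne: "A \<noteq> {}" "B \<noteq> {}" using cA cB s(1) by auto
  obtain p q where "p \<in> A" "q \<in> B" using ne by blast
  then have pq: "p \<in> ?J" "p \<le> i" "q \<in> ?J" "i < q" by (auto simp: A_def B_def)
  have iJ: "i \<in> ?J" "i + 1 \<in> ?J"
    using box_indices_convex[of z p L q, OF pos] pq by auto
  have mono: "?x j \<le> ?x k" if "j \<le> k" for j k
    using that strict_mono_less_eq[OF renewal_point_strict_mono[of z, OF pos]] by auto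
  have gap: "?x (i + 1) = ?x i + z i"
    using renewal_point_step[of z "i + 1"] by simp
  have sumB: "(\<Sum>k\<in>B. exp (- (?d * (?x k - ?x (i + 1)) powr \<alpha>))) \<le> real m * ?S"
  proof -
    let ?T = "{t. i + 1 + int t \<in> ?J}"
    have B: "B = (\<lambda>t. i + 1 + int t) ` ?T"
    proof (intro equalityI subsetI)
      fix k assume "k \<in> B"
      then show "k \<in> (\<lambda>t. i + 1 + int t) ` ?T"
        by (intro image_eqI[of _ _ "nat (k - i - 1)"]) (auto simp: B_def)
    qed (auto simp: B_def)
    have inj: "inj_on (\<lambda>t. i + 1 + int t) ?T" by (auto simp: inj_on_def)
    have "finite ?T" using finAB(2) unfolding B by (rule finite_imageD[OF _ inj])
    then show ?thesis
      unfolding B sum.reindex[OF inj] o_def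
      using iJ by (intro sum_exp_spread_le \<alpha> m renewal_point_spread[of z, OF pos m spread]) auto
  qed
  have sumA: "(\<Sum>k\<in>A. exp (- (?d * (?x i - ?x k) powr \<alpha>))) \<le> real m * ?S"
  proof -
    let ?T = "{t. i - int t \<in> ?J}"
    have A: "A = (\<lambda>t. i - int t) ` ?T"
    proof (intro equalityI subsetI)
      fix k assume "k \<in> A"
      then show "k \<in> (\<lambda>t. i - int t) ` ?T"
        by (intro image_eqI[of _ _ "nat (i - k)"]) (auto simp: A_def)
    qed (auto simp: A_def)
    have inj: "inj_on (\<lambda>t. i - int t) ?T" by (auto simp: inj_on_def)
    have "finite ?T" using finAB(1) unfolding A by (rule finite_imageD[OF _ inj])
    moreover have "real (t div m) \<le> ?x i - ?x (i - int t)" if "t \<in> ?T" for t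
      using renewal_point_spread[of z m L "i - int t" t, OF pos m spread] iJ that by simp
    ultimately show ?thesis
      unfolding A sum.reindex[OF inj] o_def
      by (intro sum_exp_spread_le \<alpha> m) auto
  qed
  let ?E = "(real m * ?S)\<^sup>2 * exp (- (?d * \<beta> powr \<alpha>))"
  have cross: "(\<Sum>j\<in>A. \<Sum>k\<in>B. exp (- (\<bar>?x j - ?x k\<bar> powr \<alpha>))) \<le> ?E"
  proof -
    have "exp (- (\<bar>?x j - ?x k\<bar> powr \<alpha>)) \<le>
        exp (- (?d * (?x i - ?x j) powr \<alpha>)) * exp (- (?d * (?x k - ?x (i + 1)) powr \<alpha>)) * exp (- (?d * \<beta> powr \<alpha>))"
      if "j \<in> A" "k \<in> B" for j k
    proof -
      have nn: "0 \<le> ?x i - ?x j" "0 \<le> ?x k - ?x (i + 1)"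
        using that mono[of j i] mono[of "i + 1" k] by (auto simp: A_def B_def)
      have "?d * ((?x i - ?x j) powr \<alpha> + (?x k - ?x (i + 1)) powr \<alpha> + \<beta> powr \<alpha>)
          \<le> ((?x i - ?x j) + (?x k - ?x (i + 1)) + \<beta>) powr \<alpha>"
        using powr_sum3_ge[OF \<alpha> nn \<beta>(1)] .
      also have "\<dots> \<le> \<bar>?x j - ?x k\<bar> powr \<alpha>"
        using nn \<beta> \<alpha> gap by (intro powr_mono2) auto
      finally show ?thesis by (simp add: exp_add[symmetric] distrib_left)
    qed
    then have "(\<Sum>j\<in>A. \<Sum>k\<in>B. exp (- (\<bar>?x j - ?x k\<bar> powr \<alpha>))) \<le>
        (\<Sum>j\<in>A. \<Sum>k\<in>B. exp (- (?d * (?x i - ?x j) powr \<alpha>)) * exp (- (?d * (?x k - ?x (i + 1)) powr \<alpha>)) * exp (- (?d * \<beta> powr \<alpha>)))"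
      by (intro sum_mono) auto
    also have "\<dots> = (\<Sum>j\<in>A. exp (- (?d * (?x i - ?x j) powr \<alpha>))) *
        (\<Sum>k\<in>B. exp (- (?d * (?x k - ?x (i + 1)) powr \<alpha>))) * exp (- (?d * \<beta> powr \<alpha>))"
      by (simp only: sum_product) (simp only: sum_distrib_right)
    also have "\<dots> \<le> (real m * ?S) * (real m * ?S) * exp (- (?d * \<beta> powr \<alpha>))"
      using sumA sumB interaction_sum_pos[OF \<alpha>]
      by (intro mult_right_mono mult_mono) (auto intro!: sum_nonneg)
    finally show ?thesis by (simp add: power2_eq_square)
  qed
  have diffs: "?J - A = B" "?J - B = A" by (auto simp: A_def B_def)
  have split: "card ?J = card A + card B"
  proof -
    have "?J = A \<union> B" "A \<inter> B = {}" by (auto simp: A_def B_def)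
    then show ?thesis using card_Un_disjoint[OF finAB] by simp
  qed
  have divide: "c / real n \<le> ?E / s" if "c \<le> ?E" "s \<le> real n" for c n
    using that s(1) by (intro frac_le) auto
  show ?thesis
  proof (cases "card A \<le> card B")
    case True
    have "cheeger \<alpha> L (renewal_process z) \<le>
        (\<Sum>j\<in>A. \<Sum>k\<in>?J - A. exp (- (\<bar>?x j - ?x k\<bar> powr \<alpha>))) / real (card A)"
      using ne True split by (intro cheeger_le_ratio pos fin) (auto simp: A_def)
    also have "\<dots> \<le> ?E / s"
      unfolding diffs by (rule divide[OF cross cA])
    finally show ?thesis .
  next
    case False
    have "cheeger \<alpha> L (renewal_process z) \<le>
        (\<Sum>j\<in>B. \<Sum>k\<in>?J - B. exp (- (\<bar>?x j - ?x k\<bar> powr \<alpha>))) / real (card B)"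
      using ne False split by (intro cheeger_le_ratio pos fin) (auto simp: B_def)
    also have "(\<Sum>j\<in>B. \<Sum>k\<in>?J - B. exp (- (\<bar>?x j - ?x k\<bar> powr \<alpha>))) =
        (\<Sum>j\<in>A. \<Sum>k\<in>B. exp (- (\<bar>?x j - ?x k\<bar> powr \<alpha>)))"
      unfolding diffs by (subst sum.swap) (simp add: abs_minus_commute)
    also have "\<dots> / real (card B) \<le> ?E / s"
      by (rule divide[OF cross cB])
    finally show ?thesis .
  qed
qed

section \<open>Renewal processes: growth of the points\<close>

locale renewal_gaps = prob_space M for M :: "'s measure" +
  fixes Z :: "int \<Rightarrow> 's \<Rightarrow> real"
  assumes indep: "indep_vars (\<lambda>_. borel) Z UNIV"
    and ident: "\<And>i. distr M borel (Z i) = distr M borel (Z 0)"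
    and gap_pos: "\<And>i. AE \<omega> in M. Z i \<omega> > 0"
    and gap_integrable: "integrable M (Z 0)"
begin

definition mean_gap :: real where
  "mean_gap = expectation (Z 0)"

definition tail :: "real \<Rightarrow> real" where
  "tail t = \<P>(\<omega> in M. Z 0 \<omega> > t)"

abbreviation point :: "'s \<Rightarrow> int \<Rightarrow> real" where
  "point \<omega> \<equiv> renewal_point (\<lambda>i. Z i \<omega>)"

abbreviation visible :: "'s \<Rightarrow> nat \<Rightarrow> int set" where
  "visible \<omega> L \<equiv> box_indices (\<lambda>i. Z i \<omega>) (real L)"

lemma gap_measurable [measurable]: "random_variable borel (Z i)"
  using indep by (simp add: indep_vars_def)

lemma mean_gap_pos: "mean_gap > 0"
  unfolding mean_gap_def using gap_integrable gap_pos by (rule expectation_greater)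

lemma AE_gaps_pos: "AE \<omega> in M. \<forall>i. Z i \<omega> > 0"
  by (simp add: AE_all_countable gap_pos)

lemma gap_distr_comp:
  assumes [measurable]: "g \<in> borel_measurable borel"
  shows "distr M borel (\<lambda>\<omega>. g (Z i \<omega>)) = distr M borel (\<lambda>\<omega>. g (Z 0 \<omega>))"
  using arg_cong[OF ident[of i], of "\<lambda>N. distr N borel g"] by (simp add: distr_distr o_def)

lemma gap_expectation:
  assumes [measurable]: "g \<in> borel_measurable borel"
  shows "expectation (\<lambda>\<omega>. g (Z i \<omega>)) = (expectation (\<lambda>\<omega>. g (Z 0 \<omega>)) :: real)"
  using arg_cong[OF ident[of i], of "\<lambda>N. integral\<^sup>L N g"] by (simp add: integral_distr)

lemma gap_integrable': "integrable M (Z i)"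
proof -
  have "integrable (distr M borel (Z 0)) (\<lambda>x. x)"
    using gap_integrable by (subst integrable_distr_eq) auto
  then have "integrable (distr M borel (Z i)) (\<lambda>x. x)" by (simp add: ident[of i])
  then show ?thesis by (subst (asm) integrable_distr_eq) auto
qed

lemma gap_prob:
  assumes "B \<in> sets borel"
  shows "\<P>(\<omega> in M. Z i \<omega> \<in> B) = \<P>(\<omega> in M. Z 0 \<omega> \<in> B)"
  using arg_cong[OF ident[of i], of "\<lambda>N. measure N B"] assms
  by (simp add: measure_distr vimage_def Int_def conj_commute)

lemma gap_tail: "\<P>(\<omega> in M. Z i \<omega> > t) = tail t"
  using gap_prob[of "{t<..}" i] by (simp add: tail_def)

lemma gap_tail_compl: "\<P>(\<omega> in M. Z i \<omega> \<le> t) = 1 - tail t"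
proof -
  have "{\<omega>\<in>space M. Z i \<omega> \<le> t} = space M - {\<omega>\<in>space M. Z i \<omega> > t}" by auto
  then show ?thesis using prob_compl[of "{\<omega>\<in>space M. Z i \<omega> > t}"] gap_tail[of t i] by simp
qed

lemma tail_le_1: "0 \<le> tail t" "tail t \<le> 1"
  by (simp_all add: tail_def)

lemma gap_sums_drift:
  fixes f :: "nat \<Rightarrow> int"
  assumes f: "inj f" and c: "s * mean_gap < c"
  shows "AE \<omega> in M. \<exists>B. \<forall>n. s * (\<Sum>i<n. Z (f i) \<omega>) \<le> c * real n + B"
proof -
  let ?X = "\<lambda>i \<omega>. s * Z (f i) \<omega> - c"
  have "indep_vars (\<lambda>_. borel) ?X UNIV"
    by (rule indep_vars_compose2[OF indep_vars_inj_reindex[OF indep f]]) simp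
  moreover have "distr M borel (?X i) = distr M borel (?X 0)" for i
    using gap_distr_comp[of "\<lambda>x. s * x - c" "f i"] gap_distr_comp[of "\<lambda>x. s * x - c" "f 0"] by simp
  moreover have "integrable M (?X 0)"
    using gap_integrable'[of "f 0"] by simp
  moreover have "expectation (?X 0) < 0"
    using gap_expectation[of "\<lambda>x. x" "f 0"] gap_integrable'[of "f 0"] c
    by (simp add: mean_gap_def prob_space)
  ultimately have "AE \<omega> in M. bdd_above (range (\<lambda>n. \<Sum>i<n. ?X i \<omega>))"
    by (rule negative_drift_bdd_above)
  then show ?thesis
  proof eventually_elim
    case (elim \<omega>)
    then obtain B where "\<And>n. (\<Sum>i<n. ?X i \<omega>) \<le> B" by (auto simp: bdd_above_def)
    then have "s * (\<Sum>i<n. Z (f i) \<omega>) \<le> c * real n + B" for n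
      by (simp add: sum_subtractf sum_distrib_left[symmetric] algebra_simps)
    then show ?case by blast
  qed
qed

text \<open>The law of large numbers, in the form of linear upper (\<open>s = 1\<close>) and lower (\<open>s = -1\<close>) bounds.\<close>

lemma point_drift:
  assumes c: "s * mean_gap < c"
  shows "AE \<omega> in M. \<exists>B. \<forall>k. s * \<bar>point \<omega> k\<bar> \<le> c * \<bar>real_of_int k\<bar> + B"
proof -
  have "inj int" "inj (\<lambda>i. - 1 - int i)" by (auto simp: inj_def)
  note sums = this[THEN gap_sums_drift, OF c]
  show ?thesis
    using sums AE_gaps_pos
  proof eventually_elim
    case (elim \<omega>)
    then obtain B1 B2 where B1: "\<And>n. s * (\<Sum>i<n. Z (int i) \<omega>) \<le> c * real n + B1"
      and B2: "\<And>n. s * (\<Sum>i<n. Z (- 1 - int i) \<omega>) \<le> c * real n + B2" by blast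
    have "s * \<bar>point \<omega> k\<bar> \<le> c * \<bar>real_of_int k\<bar> + max B1 B2" for k
    proof (cases "k \<ge> 0")
      case True
      define n where "n = nat k"
      have k: "k = int n" using True by (simp add: n_def)
      have p: "point \<omega> k = (\<Sum>i<n. Z (int i) \<omega>)"
        using renewal_point_add[of "\<lambda>i. Z i \<omega>" 0 n] by (simp add: k renewal_point_0)
      have "0 \<le> point \<omega> k" unfolding p using elim(3) by (intro sum_nonneg) (auto intro: less_imp_le)
      with B1[of n] p show ?thesis by (simp add: k)
    next
      case False
      define n where "n = nat (- k)"
      have k: "k = - int n" using False by (simp add: n_def)
      have "(\<Sum>i<n. Z (- 1 - int i) \<omega>) = (\<Sum>i<n. Z (- int n + int (n - Suc i)) \<omega>)"
        by (intro sum.cong refl) (auto simp: of_nat_diff algebra_simps intro!: arg_cong2[of _ _ _ _ Z])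
      also have "\<dots> = (\<Sum>i<n. Z (- int n + int i) \<omega>)"
        by (rule sum.nat_diff_reindex)
      finally have p: "point \<omega> k = - (\<Sum>i<n. Z (- 1 - int i) \<omega>)"
        using renewal_point_add[of "\<lambda>i. Z i \<omega>" "- int n" n] by (simp add: k renewal_point_0)
      have "point \<omega> k \<le> 0" unfolding p using elim(3) by (simp add: sum_nonneg less_imp_le)
      with B2[of n] p show ?thesis by (simp add: k)
    qed
    then show ?case by blast
  qed
qed

lemma box_indices_outer:
  assumes c: "1 / (2 * mean_gap) < c"
  shows "AE \<omega> in M. \<forall>\<^sub>F L in sequentially. \<forall>k\<in>visible \<omega> L. \<bar>real_of_int k\<bar> \<le> c * real L"
proof -
  have c0: "c > 0" using c mean_gap_pos by (smt (verit) divide_pos_pos)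
  define \<delta> where "\<delta> = (1 / (2 * c) + mean_gap) / 2"
  have "1 / (2 * c) < mean_gap" using c c0 mean_gap_pos by (simp add: field_simps)
  then have \<delta>: "1 / (2 * c) < \<delta>" "\<delta> < mean_gap" by (auto simp: \<delta>_def field_simps)
  have \<delta>0: "\<delta> > 0" using \<delta>(1) c0 by (smt (verit) divide_pos_pos)
  have pos: "c * \<delta> - 1 / 2 > 0" using \<delta>(1) c0 by (simp add: field_simps)
  have "AE \<omega> in M. \<exists>B. \<forall>k. - 1 * \<bar>point \<omega> k\<bar> \<le> - \<delta> * \<bar>real_of_int k\<bar> + B"
    using \<delta>(2) by (intro point_drift) simp
  then show ?thesis
  proof eventually_elim
    case (elim \<omega>)
    then obtain B where B': "\<And>k. - 1 * \<bar>point \<omega> k\<bar> \<le> - \<delta> * \<bar>real_of_int k\<bar> + B" by blast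
    have B: "\<delta> * \<bar>real_of_int k\<bar> \<le> \<bar>point \<omega> k\<bar> + B" for k
      using B'[of k] by simp
    have "\<forall>\<^sub>F L :: nat in sequentially. B \<le> (c * \<delta> - 1 / 2) * real L"
      using pos by real_asymp
    then show ?case
    proof eventually_elim
      case (elim L)
      show ?case
      proof
        fix k assume "k \<in> visible \<omega> L"
        then have "\<delta> * \<bar>real_of_int k\<bar> \<le> real L / 2 + B"
          using B[of k] by (simp add: box_indices_def)
        also have "\<dots> \<le> \<delta> * (c * real L)" using elim by (simp add: algebra_simps)
        finally show "\<bar>real_of_int k\<bar> \<le> c * real L" using \<delta>0 by simp
      qed
    qed
  qed
qed

lemma box_indices_inner:
  assumes c: "0 \<le> c" "c < 1 / (2 * mean_gap)"
  shows "AE \<omega> in M. \<forall>\<^sub>F L in sequentially. \<forall>k. \<bar>real_of_int k\<bar> \<le> c * real L \<longrightarrow> k \<in> visible \<omega> L"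
proof -
  obtain \<delta> where \<delta>: "mean_gap < \<delta>" "\<delta> * c < 1 / 2"
  proof (cases "c = 0")
    case True
    then show ?thesis using that[of "mean_gap + 1"] by simp
  next
    case False
    with c have c0: "c > 0" by simp
    then have "mean_gap < 1 / (2 * c)" using c mean_gap_pos by (simp add: field_simps)
    then obtain \<delta> where "mean_gap < \<delta>" "\<delta> < 1 / (2 * c)" using dense by blast
    then show ?thesis using c0 that[of \<delta>] by (simp add: field_simps)
  qed
  have pos: "1 / 2 - \<delta> * c > 0" using \<delta>(2) by simp
  have "AE \<omega> in M. \<exists>B. \<forall>k. 1 * \<bar>point \<omega> k\<bar> \<le> \<delta> * \<bar>real_of_int k\<bar> + B"
    using \<delta>(1) by (intro point_drift) simp
  then show ?thesis
  proof eventually_elim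
    case (elim \<omega>)
    then obtain B where B: "\<And>k. \<bar>point \<omega> k\<bar> \<le> \<delta> * \<bar>real_of_int k\<bar> + B" by auto
    have "\<forall>\<^sub>F L :: nat in sequentially. B \<le> (1 / 2 - \<delta> * c) * real L"
      using pos by real_asymp
    then show ?case
    proof eventually_elim
      case (elim L)
      show ?case
      proof (intro allI impI)
        fix k assume k: "\<bar>real_of_int k\<bar> \<le> c * real L"
        have "\<bar>point \<omega> k\<bar> \<le> \<delta> * (c * real L) + B"
          using B[of k] mult_left_mono[OF k, of \<delta>] \<delta>(1) mean_gap_pos by linarith
        also have "\<dots> \<le> real L / 2" using elim by (simp add: algebra_simps)
        finally show "k \<in> visible \<omega> L" by (simp add: box_indices_def)
      qed
    qed
  qed
qed

lemma finite_box_indices: "AE \<omega> in M. \<forall>\<^sub>F L in sequentially. finite (visible \<omega> L)"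
  using box_indices_outer[of "1 / (2 * mean_gap) + 1", simplified]
proof eventually_elim
  case (elim \<omega>)
  then show ?case
  proof eventually_elim
    case (elim L)
    let ?n = "\<lfloor>(1 / (2 * mean_gap) + 1) * real L\<rfloor>"
    have "visible \<omega> L \<subseteq> {- ?n..?n}"
      using elim by (force simp: abs_le_iff le_floor_iff minus_le_iff)
    then show ?case by (rule finite_subset) simp
  qed
qed

end

section \<open>Extremal gaps\<close>

text \<open>The expectation of the random series is finite. With unit weights this is the first Borel-Cantelli
  lemma.\<close>

lemma (in prob_space) AE_summable_indicator:
  fixes c :: "nat \<Rightarrow> real"
  assumes [measurable]: "\<And>n. E n \<in> events" and c: "\<And>n. 0 \<le> c n"
    and sum: "summable (\<lambda>n. c n * prob (E n))"
  shows "AE \<omega> in M. summable (\<lambda>n. c n * indicator (E n) \<omega>)"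
proof -
  let ?f = "\<lambda>n \<omega>. ennreal (c n * indicator (E n) \<omega>)"
  have "(\<integral>\<^sup>+\<omega>. ?f n \<omega> \<partial>M) = ennreal (c n * prob (E n))" for n
    using c by (simp add: ennreal_mult emeasure_eq_measure ennreal_indicator nn_integral_cmult)
  then have "(\<integral>\<^sup>+\<omega>. (\<Sum>n. ?f n \<omega>) \<partial>M) = (\<Sum>n. ennreal (c n * prob (E n)))"
    by (subst nn_integral_suminf) auto
  also have "\<dots> = ennreal (\<Sum>n. c n * prob (E n))"
    using c sum by (intro suminf_ennreal2) auto
  finally have "(\<integral>\<^sup>+\<omega>. (\<Sum>n. ?f n \<omega>) \<partial>M) \<noteq> \<infinity>" by simp
  then have "AE \<omega> in M. (\<Sum>n. ?f n \<omega>) \<noteq> \<infinity>"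
    by (intro nn_integral_noteq_infinite) auto
  then show ?thesis
    by eventually_elim (use c in \<open>auto intro!: summable_suminf_not_top\<close>)
qed

text \<open>A summable series with weights \<open>1/n\<close> cannot contain the whole of \<open>[n, \<theta>n]\<close> for large \<open>n\<close>, since
  such a stretch has harmonic mass at least \<open>(\<theta> - 1)/\<theta>\<close>.\<close>

lemma harmonic_summable_gaps:
  assumes sum: "summable (\<lambda>n. 1 / real n * indicator {n. P n} n)" and \<theta>: "\<theta> > 1"
  shows "\<forall>\<^sub>F n in sequentially. \<exists>n'. n \<le> n' \<and> real n' \<le> \<theta> * real n \<and> \<not> P n'"
proof -
  let ?f = "\<lambda>n. 1 / real n * indicator {n. P n} n"
  have "(\<theta> - 1) / \<theta> > 0" using \<theta> by simp
  then obtain N where N: "\<And>m n. m \<ge> N \<Longrightarrow> norm (sum ?f {m..<n}) < (\<theta> - 1) / \<theta>"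
    using sum unfolding summable_Cauchy by meson
  show ?thesis
    using eventually_ge_at_top[of "max N 1"]
  proof eventually_elim
    case (elim n)
    show ?case
    proof (rule ccontr)
      assume "\<not> ?thesis"
      then have P: "P n'" if "n \<le> n'" "real n' \<le> \<theta> * real n" for n' using that by blast
      define k where "k = nat \<lfloor>\<theta> * real n\<rfloor> + 1"
      have k: "real k > \<theta> * real n" unfolding k_def by linarith
      have le: "real n' \<le> \<theta> * real n" if "n' < k" for n'
        using that \<theta> unfolding k_def by (simp add: le_nat_iff le_floor_iff less_Suc_eq_le)
      have "(\<theta> - 1) / \<theta> = (\<theta> * real n - real n) * (1 / (\<theta> * real n))"
        using elim \<theta> by (simp add: field_simps)
      also have "\<dots> \<le> (real k - real n) * (1 / (\<theta> * real n))"
        using k \<theta> by (intro mult_right_mono) auto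
      also have "real k - real n \<le> real (card {n..<k})" by simp
      then have "(real k - real n) * (1 / (\<theta> * real n)) \<le> real (card {n..<k}) * (1 / (\<theta> * real n))"
        using \<theta> by (intro mult_right_mono) auto
      also have "\<dots> = (\<Sum>n'\<in>{n..<k}. 1 / (\<theta> * real n))" by simp
      also have "\<dots> \<le> sum ?f {n..<k}"
      proof (rule sum_mono)
        fix n' assume n': "n' \<in> {n..<k}"
        then have "P n'" "real n' \<le> \<theta> * real n" using P le by auto
        then show "1 / (\<theta> * real n) \<le> ?f n'" using n' elim by (auto intro!: divide_left_mono)
      qed
      also have "\<dots> \<le> norm (sum ?f {n..<k})" by simp
      also have "\<dots> < (\<theta> - 1) / \<theta>" using elim by (intro N) simp
      finally show False by simp
    qed
  qed
qed

lemma abs_int_decode_le: "2 * \<bar>int_decode k\<bar> \<le> int k + 1"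
proof (cases "even k")
  case True
  then show ?thesis by (auto simp: int_decode_def sum_decode_def)
next
  case False
  then have "int k = 2 * int (k div 2) + 1" by presburger
  then show ?thesis using False by (simp add: int_decode_def sum_decode_def)
qed

context renewal_gaps
begin

text \<open>Borel-Cantelli handles all gaps except finitely many. A single gap is eventually below \<open>a n\<close> because
  \<open>tail (a n)\<close> tends to zero; this covers the case of a bounded function \<open>a\<close> too.\<close>

lemma gaps_eventually_le:
  assumes mono: "mono_on {0..} a" and sum: "summable (\<lambda>n::nat. tail (a (real n)))"
  shows "AE \<omega> in M. \<forall>\<^sub>F n in sequentially. \<forall>i. \<bar>i\<bar> \<le> int n \<longrightarrow> Z i \<omega> \<le> a (real n)"
proof -
  have a_mono: "a (real m) \<le> a (real n)" if "m \<le> n" for m n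
    using that by (intro mono_onD[OF mono]) auto
  have far: "AE \<omega> in M. \<forall>\<^sub>F n in sequentially. Z (s * int n) \<omega> \<le> a (real n)" for s
  proof -
    have "AE \<omega> in M. \<forall>\<^sub>F n in sequentially. \<omega> \<in> space M - {\<omega>\<in>space M. Z (s * int n) \<omega> > a (real n)}"
      using sum by (intro borel_cantelli_AE1) (auto simp: gap_tail emeasure_eq_measure)
    then show ?thesis
      by eventually_elim (auto elim!: eventually_mono simp: not_less)
  qed
  have near: "AE \<omega> in M. \<forall>i. \<exists>n. Z i \<omega> \<le> a (real n)"
  proof (subst AE_all_countable, rule allI)
    fix i
    let ?E = "{\<omega>\<in>space M. \<forall>n. Z i \<omega> > a (real n)}"
    have "prob ?E \<le> tail (a (real n))" for n
      unfolding gap_tail[of "a (real n)" i, symmetric] by (intro finite_measure_mono) auto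
    then have "prob ?E \<le> 0"
      using summable_LIMSEQ_zero[OF sum] by (intro LIMSEQ_le_const) auto
    then have "prob ?E = 0" by (simp add: measure_le_0_iff)
    then show "AE \<omega> in M. \<exists>n. Z i \<omega> \<le> a (real n)"
      by (intro AE_I[of _ _ ?E]) (auto simp: emeasure_eq_measure not_le)
  qed
  show ?thesis
    using far[of 1] far[of "- 1"] near
  proof eventually_elim
    case (elim \<omega>)
    have "\<forall>\<^sub>F n in sequentially. Z (int n) \<omega> \<le> a (real n) \<and> Z (- int n) \<omega> \<le> a (real n)"
      using elim(1,2) by eventually_elim auto
    then obtain N where N: "\<And>n. n \<ge> N \<Longrightarrow> Z (int n) \<omega> \<le> a (real n) \<and> Z (- int n) \<omega> \<le> a (real n)"
      by (auto simp: eventually_sequentially)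
    have "\<forall>\<^sub>F n in sequentially. \<forall>i\<in>{- int N..int N}. Z i \<omega> \<le> a (real n)"
    proof (intro eventually_ball_finite ballI)
      fix i
      obtain m where "Z i \<omega> \<le> a (real m)" using elim(3) by blast
      then show "\<forall>\<^sub>F n in sequentially. Z i \<omega> \<le> a (real n)"
        by (intro eventually_sequentiallyI[of m]) (use a_mono order.trans in blast)
    qed simp
    then show ?case
    proof eventually_elim
      case (elim n)
      show ?case
      proof (intro allI impI)
        fix i assume i: "\<bar>i\<bar> \<le> int n"
        show "Z i \<omega> \<le> a (real n)"
        proof (cases "\<bar>i\<bar> \<le> int N")
          case True
          then have "i \<in> {- int N..int N}" unfolding atLeastAtMost_iff by linarith
          then show ?thesis using elim by blast
        next
          case False
          then have "Z i \<omega> \<le> a (real (nat \<bar>i\<bar>))"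
            using N[of "nat \<bar>i\<bar>"] by (cases "i \<ge> 0") auto
          also have "\<dots> \<le> a (real n)" using i by (intro a_mono) simp
          finally show ?thesis .
        qed
      qed
    qed
  qed
qed

text \<open>The window of the first \<open>n\<close> integers in the enumeration \<open>0, -1, 1, -2, \<dots>\<close> is centred up to one
  place, grows with \<open>n\<close>, and has exactly \<open>n\<close> elements.\<close>

lemma prob_no_large_gap:
  "\<P>(\<omega> in M. \<forall>k<n. Z (int_decode k) \<omega> \<le> t) \<le> exp (- (real n * tail t))"
proof (cases "n = 0")
  case False
  let ?W = "int_decode ` {..<n}"
  have "{\<omega>\<in>space M. \<forall>k<n. Z (int_decode k) \<omega> \<le> t} = (\<Inter>i\<in>?W. Z i -` {..t} \<inter> space M)"
    using False by auto
  then have "\<P>(\<omega> in M. \<forall>k<n. Z (int_decode k) \<omega> \<le> t) = (\<Prod>i\<in>?W. prob (Z i -` {..t} \<inter> space M))"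
    using False by (simp only:) (intro indep_varsD[OF indep], auto)
  also have "\<dots> = (\<Prod>i\<in>?W. 1 - tail t)"
  proof (intro prod.cong refl)
    fix i
    have "Z i -` {..t} \<inter> space M = {\<omega>\<in>space M. Z i \<omega> \<le> t}" by auto
    then show "prob (Z i -` {..t} \<inter> space M) = 1 - tail t" using gap_tail_compl[of i t] by simp
  qed
  also have "\<dots> = (1 - tail t) ^ n"
    by (simp add: card_image inj_int_decode)
  also have "\<dots> \<le> exp (- tail t) ^ n"
    using tail_le_1[of t] exp_ge_add_one_self[of "- tail t"] by (intro power_mono) auto
  also have "\<dots> = exp (- (real n * tail t))"
    by (simp add: exp_of_nat_mult[symmetric])
  finally show ?thesis .
qed simp

text \<open>Since \<open>n * tail (b n)\<close> is eventually at least one, the hypothesis makes the probabilities that the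
  window of size \<open>n\<close> has no gap above \<open>b n\<close> summable with weights \<open>1/n\<close>. These
  weights suffice because one good window size in each \<open>[n, \<theta>n]\<close> is enough for the application: windows and
  \<open>b\<close> both grow, and the factor \<open>\<theta>\<close> is compensated by restricting to fewer gaps.\<close>

lemma large_gap_eventually:
  assumes lim: "filterlim (\<lambda>n::nat. real n * tail (b (real n))) at_top sequentially"
    and sum: "summable (\<lambda>n::nat. tail (b (real n)) * exp (- (real n * tail (b (real n)))))"
    and \<theta>: "\<theta> > 1"
  shows "AE \<omega> in M. \<forall>\<^sub>F n in sequentially. \<exists>n' i. n \<le> n' \<and> real n' \<le> \<theta> * real n \<and>
    2 * \<bar>i\<bar> \<le> int n' \<and> b (real n') < Z i \<omega>"
proof -
  define E where "E n = {\<omega>\<in>space M. \<forall>k<n. Z (int_decode k) \<omega> \<le> b (real n)}" for n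
  have E [measurable]: "E n \<in> events" for n unfolding E_def by measurable
  have "summable (\<lambda>n. 1 / real n * prob (E n))"
  proof (rule summable_comparison_test_ev[OF _ sum])
    have "\<forall>\<^sub>F n in sequentially. 1 \<le> real n * tail (b (real n))"
      using lim unfolding filterlim_at_top by blast
    then show "\<forall>\<^sub>F n in sequentially. norm (1 / real n * prob (E n))
        \<le> tail (b (real n)) * exp (- (real n * tail (b (real n))))"
      using eventually_gt_at_top[of 0]
    proof eventually_elim
      case (elim n)
      have "1 / real n * prob (E n) \<le> tail (b (real n)) * exp (- (real n * tail (b (real n))))"
        unfolding E_def using elim
        by (intro mult_mono prob_no_large_gap) (auto simp: field_simps tail_le_1)
      then show ?case by simp
    qed
  qed
  then have "AE \<omega> in M. summable (\<lambda>n. 1 / real n * indicator (E n) \<omega>)"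
    by (intro AE_summable_indicator) auto
  then show ?thesis
    using AE_space
  proof eventually_elim
    case (elim \<omega>)
    have eq: "indicator (E n) \<omega> = (indicator {n. \<omega> \<in> E n} n :: real)" for n
      by (simp add: indicator_def)
    have "\<forall>\<^sub>F n in sequentially. \<exists>n'. n \<le> n' \<and> real n' \<le> \<theta> * real n \<and> \<omega> \<notin> E n'"
      by (rule harmonic_summable_gaps[OF _ \<theta>]) (use elim(1) in \<open>simp only: eq\<close>)
    then show ?case
    proof eventually_elim
      case (elim n)
      then obtain n' where n': "n \<le> n'" "real n' \<le> \<theta> * real n" "\<omega> \<notin> E n'" by blast
      then obtain k where k: "k < n'" "b (real n') < Z (int_decode k) \<omega>"
        using \<open>\<omega> \<in> space M\<close> by (auto simp: E_def not_le)
      have "2 * \<bar>int_decode k\<bar> \<le> int n'" using abs_int_decode_le[of k] k(1) by linarith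
      then show ?case using n' k(2) by blast
    qed
  qed
qed

section \<open>Clusters of points\<close>

lemma laplace_bounds: "0 < expectation (\<lambda>\<omega>. exp (- Z 0 \<omega>))" "expectation (\<lambda>\<omega>. exp (- Z 0 \<omega>)) < 1"
  and laplace_integrable: "integrable M (\<lambda>\<omega>. exp (- Z i \<omega>))"
proof -
  show int: "integrable M (\<lambda>\<omega>. exp (- Z i \<omega>))" for i
    by (rule integrable_const_bound[where B = 1]) (use gap_pos[of i] in auto)
  show "0 < expectation (\<lambda>\<omega>. exp (- Z 0 \<omega>))"
    by (rule expectation_greater[OF int]) simp
  show "expectation (\<lambda>\<omega>. exp (- Z 0 \<omega>)) < 1"
    by (rule expectation_less[OF int]) (use gap_pos[of 0] in auto)
qed

text \<open>Markov's inequality for \<open>exp (- s)\<close>, where \<open>s\<close> is the length of the cluster.\<close>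

lemma prob_cluster_le:
  "\<P>(\<omega> in M. point \<omega> (k + int m) - point \<omega> k \<le> 1) \<le> exp 1 * expectation (\<lambda>\<omega>. exp (- Z 0 \<omega>)) ^ m"
proof -
  let ?X = "\<lambda>t \<omega>. exp (- Z (k + int t) \<omega>)"
  have indep_X: "indep_vars (\<lambda>_. borel) ?X {..<m}"
  proof -
    have "inj (\<lambda>t. k + int t)" by (auto simp: inj_def)
    from indep_vars_inj_reindex[OF indep this]
    have "indep_vars (\<lambda>_. borel) ?X UNIV"
      by (rule indep_vars_compose2) simp
    then show ?thesis by (rule indep_vars_subset) simp
  qed
  have prod: "(\<Prod>t<m. ?X t \<omega>) = exp (- (point \<omega> (k + int m) - point \<omega> k))" for \<omega>
    by (simp add: exp_sum[symmetric] sum_negf renewal_point_add)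
  have "\<P>(\<omega> in M. point \<omega> (k + int m) - point \<omega> k \<le> 1) = \<P>(\<omega> in M. (\<Prod>t<m. ?X t \<omega>) \<ge> exp (- 1))"
    unfolding prod exp_le_cancel_iff by (intro arg_cong[of _ _ prob]) auto
  also have "\<dots> \<le> expectation (\<lambda>\<omega>. \<Prod>t<m. ?X t \<omega>) / exp (- 1)"
    using indep_vars_integrable[OF _ indep_X] laplace_integrable
    by (intro integral_Markov_inequality_measure[where A = "{}"]) (auto intro!: prod_nonneg)
  also have "expectation (\<lambda>\<omega>. \<Prod>t<m. ?X t \<omega>) = (\<Prod>t<m. expectation (?X t))"
    using laplace_integrable by (intro indep_vars_lebesgue_integral indep_X) auto
  also have "\<dots> = expectation (\<lambda>\<omega>. exp (- Z 0 \<omega>)) ^ m"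
  proof -
    have "expectation (?X t) = expectation (\<lambda>\<omega>. exp (- Z 0 \<omega>))" for t
      by (rule gap_expectation[of "\<lambda>x. exp (- x)"]) simp
    then show ?thesis by (simp only: prod_constant card_lessThan)
  qed
  finally show ?thesis by (simp add: exp_minus field_simps)
qed

text \<open>The bound for a single cluster decays geometrically in the number of points, so a logarithmic
  number of points beats a union bound over the box.\<close>

lemma log_clusters:
  assumes c: "0 \<le> c"
  shows "\<exists>K>0. AE \<omega> in M. \<forall>\<^sub>F L in sequentially. \<forall>k. \<bar>real_of_int k\<bar> \<le> c * real L \<longrightarrow>
    1 \<le> point \<omega> (k + int (nat \<lceil>K * ln (real L)\<rceil>)) - point \<omega> k"
proof -
  define \<rho> where "\<rho> = expectation (\<lambda>\<omega>. exp (- Z 0 \<omega>))"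
  have \<rho>: "0 < \<rho>" "\<rho> < 1" using laplace_bounds by (simp_all add: \<rho>_def)
  \<comment> \<open>with this choice a cluster has probability of order \<open>L\<^sup>-\<^sup>3\<close>, and their union of order \<open>L\<^sup>-\<^sup>2\<close>\<close>
  define K where "K = 3 / (- ln \<rho>)"
  have K: "K > 0" "K * ln \<rho> = - 3" using \<rho> by (auto simp: K_def)
  define m where "m L = nat \<lceil>K * ln (real L)\<rceil>" for L :: nat
  define I where "I L = {- \<lfloor>c * real L\<rfloor>..\<lfloor>c * real L\<rfloor>}" for L :: nat
  have I: "k \<in> I L \<longleftrightarrow> \<bar>real_of_int k\<bar> \<le> c * real L" for k L
    unfolding I_def by (auto simp: le_floor_iff minus_le_iff abs_le_iff)
  have cardI: "real (card (I L)) \<le> 2 * c * real L + 1" for L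
  proof -
    have "0 \<le> \<lfloor>c * real L\<rfloor>" using c by simp
    then have "real (card (I L)) = 2 * real_of_int \<lfloor>c * real L\<rfloor> + 1" by (simp add: I_def)
    then show ?thesis using of_int_floor_le[of "c * real L"] by linarith
  qed
  define F where "F L k = {\<omega>\<in>space M. point \<omega> (k + int (m L)) - point \<omega> k \<le> 1}" for L k
  have meas [measurable]: "F L k \<in> events" for L k
    unfolding F_def renewal_point_def by measurable
  have bound: "prob (\<Union>k\<in>I L. F L k) \<le> (2 * c * real L + 1) * (exp 1 / real L ^ 3)" if L: "L \<ge> 1" for L
  proof -
    have "\<rho> ^ m L = exp (real (m L) * ln \<rho>)"
      using \<rho> by (simp add: exp_of_nat_mult)
    also have "\<dots> \<le> exp ((K * ln (real L)) * ln \<rho>)"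
      using ln_less_zero[OF \<rho>] unfolding exp_le_cancel_iff m_def by (intro mult_right_mono_neg) linarith+
    also have "(K * ln (real L)) * ln \<rho> = - (3 * ln (real L))"
    proof -
      have "(K * ln (real L)) * ln \<rho> = (K * ln \<rho>) * ln (real L)" by (simp only: mult_ac)
      then show ?thesis using K(2) by simp
    qed
    also have "exp (- (3 * ln (real L))) = 1 / real L ^ 3"
      using L exp_of_nat_mult[of 3 "ln (real L)"] by (simp add: exp_minus field_simps)
    finally have \<rho>m: "\<rho> ^ m L \<le> 1 / real L ^ 3" .
    have "prob (\<Union>k\<in>I L. F L k) \<le> (\<Sum>k\<in>I L. prob (F L k))"
      by (intro finite_measure_subadditive_finite) (auto simp: I_def)
    also have "\<dots> \<le> (\<Sum>k\<in>I L. exp 1 * \<rho> ^ m L)"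
      unfolding F_def \<rho>_def by (intro sum_mono prob_cluster_le)
    also have "\<dots> = real (card (I L)) * (exp 1 * \<rho> ^ m L)" by simp
    also have "\<dots> \<le> (2 * c * real L + 1) * (exp 1 * (1 / real L ^ 3))"
      using cardI[of L] \<rho>m \<rho> c by (intro mult_mono) auto
    finally show ?thesis by simp
  qed
  have "summable (\<lambda>L. prob (\<Union>k\<in>I L. F L k))"
  proof (rule summable_comparison_test_ev)
    show "\<forall>\<^sub>F L in sequentially. norm (prob (\<Union>k\<in>I L. F L k)) \<le> (2 * c * real L + 1) * (exp 1 / real L ^ 3)"
      using eventually_ge_at_top[of 1] by eventually_elim (use bound in simp)
    show "summable (\<lambda>L. (2 * c * real L + 1) * (exp 1 / real L ^ 3))"
    proof (rule summable_comparison_test_bigo)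
      show "summable (\<lambda>q::nat. norm (1 / real q ^ 2))"
        using inverse_power_summable[of 2, where 'a = real] by (simp add: inverse_eq_divide)
      have "(\<lambda>L::nat. 2 * c * real L + 1) \<in> O(\<lambda>L. real L)"
      proof -
        have "(\<lambda>L::nat. 2 * c * real L) \<in> O(\<lambda>L. real L)" by simp
        moreover have "(\<lambda>L::nat. 1 :: real) \<in> O(\<lambda>L. real L)" by real_asymp
        ultimately show ?thesis by (rule sum_in_bigo)
      qed
      moreover have "(\<lambda>L::nat. exp 1 / real L ^ 3) \<in> O(\<lambda>L. 1 / real L ^ 3)" by real_asymp
      ultimately have "(\<lambda>L::nat. (2 * c * real L + 1) * (exp 1 / real L ^ 3)) \<in> O(\<lambda>L. real L * (1 / real L ^ 3))"
        by (rule landau_o.big.mult)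
      also have "(\<lambda>L::nat. real L * (1 / real L ^ 3)) \<in> O(\<lambda>L. 1 / real L ^ 2)" by real_asymp
      finally show "(\<lambda>L::nat. (2 * c * real L + 1) * (exp 1 / real L ^ 3)) \<in> O(\<lambda>L. 1 / real L ^ 2)" .
    qed
  qed
  then have "AE \<omega> in M. \<forall>\<^sub>F L in sequentially. \<omega> \<in> space M - (\<Union>k\<in>I L. F L k)"
    by (intro borel_cantelli_AE1) (auto simp: I_def emeasure_eq_measure)
  then have "AE \<omega> in M. \<forall>\<^sub>F L in sequentially. \<forall>k. \<bar>real_of_int k\<bar> \<le> c * real L \<longrightarrow>
    1 \<le> point \<omega> (k + int (m L)) - point \<omega> k"
    by eventually_elim (auto elim!: eventually_mono simp: I[symmetric] F_def not_le intro: less_imp_le)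
  then show ?thesis using K(1) unfolding m_def by blast
qed

lemma bounded_clusters:
  assumes \<epsilon>: "\<epsilon> > 0" and away: "\<And>i. AE \<omega> in M. Z i \<omega> > \<epsilon>"
  shows "AE \<omega> in M. \<forall>k. 1 \<le> point \<omega> (k + int (nat \<lceil>1 / \<epsilon>\<rceil>)) - point \<omega> k"
proof -
  have "AE \<omega> in M. \<forall>i. Z i \<omega> > \<epsilon>" by (simp add: AE_all_countable away)
  then show ?thesis
  proof eventually_elim
    case (elim \<omega>)
    show ?case
    proof
      fix k
      let ?m = "nat \<lceil>1 / \<epsilon>\<rceil>"
      have "1 = 1 / \<epsilon> * \<epsilon>" using \<epsilon> by simp
      also have "\<dots> \<le> real ?m * \<epsilon>" using \<epsilon> by (intro mult_right_mono) linarith+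
      also have "\<dots> = (\<Sum>t<?m. \<epsilon>)" by simp
      also have "\<dots> \<le> (\<Sum>t<?m. Z (k + int t) \<omega>)"
        using elim by (intro sum_mono less_imp_le) auto
      finally show "1 \<le> point \<omega> (k + int ?m) - point \<omega> k"
        by (simp only: renewal_point_add add_diff_cancel_left')
    qed
  qed
qed

end

section \<open>Almost sure bounds for the Cheeger constant\<close>

lemma eventually_le_linear: "0 < q \<Longrightarrow> \<forall>\<^sub>F L :: nat in sequentially. B \<le> q * real L"
  by real_asymp

context renewal_gaps
begin

text \<open>The indices of the points in the box are at most about \<open>L/(2\<mu>)\<close> in absolute value, hence at most
  \<open>L/(\<gamma>\<mu>)\<close>. This controls the gaps in the box as well as the number of points.\<close>

lemma cheeger_eventually_ge:
  assumes \<alpha>: "0 \<le> \<alpha>" and \<gamma>: "\<gamma> \<in> {0<..<1}" and mono: "mono_on {0..} a" and nonneg: "\<And>t. 0 \<le> t \<Longrightarrow> 0 \<le> a t"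
    and gaps: "AE \<omega> in M. \<forall>\<^sub>F n in sequentially. \<forall>i. \<bar>i\<bar> \<le> int n \<longrightarrow> Z i \<omega> \<le> a (real n)"
  shows "\<exists>C>0. AE \<omega> in M. \<forall>\<^sub>F L :: nat in sequentially.
    1 / C * lower_rate \<alpha> mean_gap \<gamma> a (real L) \<le> cheeger \<alpha> (real L) (renewal_process (\<lambda>i. Z i \<omega>))"
proof -
  define c where "c = 1 / (\<gamma> * mean_gap)"
  have c0: "c > 0" using \<gamma> mean_gap_pos by (simp add: c_def)
  have c: "1 / (2 * mean_gap) < c" using \<gamma> mean_gap_pos by (simp add: c_def field_simps)
  define C where "C = 2 * c + 1"
  have C: "C > 0" using c0 by (simp add: C_def)
  let ?n = "\<lambda>L::nat. nat \<lfloor>c * real L\<rfloor>"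
  have n_lim: "filterlim ?n at_top sequentially"
    using c0 by real_asymp
  have "AE \<omega> in M. \<forall>\<^sub>F L in sequentially. \<forall>k. \<bar>real_of_int k\<bar> \<le> 1 / (4 * mean_gap) * real L \<longrightarrow> k \<in> visible \<omega> L"
    using mean_gap_pos by (intro box_indices_inner) (auto simp: field_simps)
  then have "AE \<omega> in M. \<forall>\<^sub>F L :: nat in sequentially.
    1 / C * lower_rate \<alpha> mean_gap \<gamma> a (real L) \<le> cheeger \<alpha> (real L) (renewal_process (\<lambda>i. Z i \<omega>))"
    using box_indices_outer[OF c] gaps AE_gaps_pos
  proof eventually_elim
    case (elim \<omega>)
    have "\<forall>\<^sub>F L in sequentially. \<forall>i. \<bar>i\<bar> \<le> int (?n L) \<longrightarrow> Z i \<omega> \<le> a (real (?n L))"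
      by (rule eventually_compose_filterlim[OF elim(3) n_lim])
    moreover have "\<forall>\<^sub>F L :: nat in sequentially. 1 \<le> 1 / (4 * mean_gap) * real L"
      using mean_gap_pos by (intro eventually_le_linear) simp
    moreover note elim(1,2) eventually_ge_at_top[of 1]
    ultimately show ?case
    proof eventually_elim
      case (elim L)
      let ?J = "visible \<omega> L"
      have n: "real (?n L) \<le> c * real L" using c0 by (simp add: of_int_floor_le)
      have J: "?J \<subseteq> {- int (?n L)..int (?n L)}"
      proof
        fix k assume "k \<in> ?J"
        then have "real_of_int \<bar>k\<bar> \<le> c * real L" using elim by simp
        then have "\<bar>k\<bar> \<le> \<lfloor>c * real L\<rfloor>" by (simp add: le_floor_iff)
        then show "k \<in> {- int (?n L)..int (?n L)}" unfolding atLeastAtMost_iff by linarith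
      qed
      have fin: "finite ?J" using J by (rule finite_subset) simp
      have "card ?J \<le> card {- int (?n L)..int (?n L)}" using J by (intro card_mono) auto
      also have "card {- int (?n L)..int (?n L)} = 2 * ?n L + 1"
        unfolding card_atLeastAtMost_int by linarith
      finally have "real (card ?J) \<le> 2 * real (?n L) + 1" by linarith
      also have "\<dots> \<le> C * real L" using n elim by (simp add: C_def algebra_simps)
      finally have cardJ: "real (card ?J) \<le> C * real L" .
      have "{0, 1} \<subseteq> ?J" using elim by auto
      then have "card {0, 1 :: int} \<le> card ?J" using fin by (intro card_mono)
      then have card2: "2 \<le> card ?J" by simp
      let ?A = "a (real L / (\<gamma> * mean_gap))"
      have gap: "Z k \<omega> \<le> ?A" if "k \<in> ?J" for k
      proof -
        have "k \<in> {- int (?n L)..int (?n L)}" using J that by blast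
        then have "\<bar>k\<bar> \<le> int (?n L)" unfolding atLeastAtMost_iff by linarith
        then have "Z k \<omega> \<le> a (real (?n L))" using elim(1) by blast
        also have "\<dots> \<le> ?A"
          using n c0 by (intro mono_onD[OF mono]) (auto simp: c_def)
        finally show ?thesis .
      qed
      have "1 / C * lower_rate \<alpha> mean_gap \<gamma> a (real L) = 1 / (C * real L) * exp (- (?A powr \<alpha>))"
        by (simp add: lower_rate_def)
      also have "\<dots> \<le> 1 / real (card ?J) * exp (- (?A powr \<alpha>))"
        using cardJ card2 C elim by (intro mult_right_mono divide_left_mono mult_pos_pos) auto
      also have "\<dots> \<le> 2 / real (card ?J) * exp (- (?A powr \<alpha>))"
        by (intro mult_right_mono divide_right_mono) auto
      also have "\<dots> \<le> cheeger \<alpha> (real L) (renewal_process (\<lambda>i. Z i \<omega>))"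
        using \<open>\<forall>i. Z i \<omega> > 0\<close> by (intro cheeger_lower_bound \<alpha> fin card2 gap) auto
      finally show ?case .
    qed
  qed
  then show ?thesis using C by blast
qed

text \<open>Either side of a gap with index at most \<open>c1 L\<close> contains a positive fraction of the points of the
  box, because the indices up to \<open>c2 L\<close> still belong to the box for some \<open>c2 > c1\<close>. The function \<open>m\<close> bounds
  the number of points in a unit interval; the two results on clusters supply it.\<close>

lemma cheeger_eventually_le:
  assumes \<alpha>: "0 < \<alpha>" and \<beta>: "\<And>L. 0 \<le> \<beta> L"
    and c1: "0 \<le> c1" "c1 < 1 / (2 * mean_gap)"
    and gap: "AE \<omega> in M. \<forall>\<^sub>F L :: nat in sequentially. \<exists>i. \<bar>real_of_int i\<bar> \<le> c1 * real L \<and> \<beta> L \<le> Z i \<omega>"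
    and m: "\<forall>\<^sub>F L in sequentially. 1 \<le> m L"
    and spread: "AE \<omega> in M. \<forall>\<^sub>F L :: nat in sequentially. \<forall>k. \<bar>real_of_int k\<bar> \<le> 1 / mean_gap * real L \<longrightarrow>
      1 \<le> point \<omega> (k + int (m L)) - point \<omega> k"
  shows "\<exists>C>0. AE \<omega> in M. \<forall>\<^sub>F L in sequentially. cheeger \<alpha> (real L) (renewal_process (\<lambda>i. Z i \<omega>))
    \<le> C * (real (m L))\<^sup>2 * (exp (- (d_exp \<alpha> * \<beta> L powr \<alpha>)) / real L)"
proof -
  obtain c2 where c2: "c1 < c2" "c2 < 1 / (2 * mean_gap)" using dense[OF c1(2)] by blast
  define \<eta> where "\<eta> = (c2 - c1) / 2"
  have \<eta>: "\<eta> > 0" using c2 by (simp add: \<eta>_def)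
  define C where "C = (interaction_sum \<alpha>)\<^sup>2 / \<eta>"
  have C: "C > 0" using interaction_sum_pos[OF \<alpha>] \<eta> by (simp add: C_def)
  have outer: "1 / (2 * mean_gap) < 1 / mean_gap" using mean_gap_pos by (simp add: field_simps)
  have c2_nonneg: "0 \<le> c2" using c1 c2 by simp
  have "AE \<omega> in M. \<forall>\<^sub>F L in sequentially. cheeger \<alpha> (real L) (renewal_process (\<lambda>i. Z i \<omega>))
    \<le> C * (real (m L))\<^sup>2 * (exp (- (d_exp \<alpha> * \<beta> L powr \<alpha>)) / real L)"
    using box_indices_outer[OF outer] box_indices_inner[OF c2_nonneg c2(2)] finite_box_indices gap spread AE_gaps_pos
  proof eventually_elim
    case (elim \<omega>)
    have "\<forall>\<^sub>F L :: nat in sequentially. 1 \<le> \<eta> * real L"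
      using \<eta> by (rule eventually_le_linear)
    with elim(1-5) m show ?case
    proof eventually_elim
      case (elim L)
      let ?J = "visible \<omega> L"
      obtain i where i: "\<bar>real_of_int i\<bar> \<le> c1 * real L" "\<beta> L \<le> Z i \<omega>" using elim by blast
      have L: "real L > 0" using elim(7) \<eta> by (cases "L = 0") auto
      let ?r = "\<lfloor>c2 * real L\<rfloor>"
      have r: "c2 * real L - 1 < real_of_int ?r" by linarith
      have far: "c1 * real L + 2 * (\<eta> * real L) = c2 * real L" by (simp add: \<eta>_def field_simps)
      have inJ: "k \<in> ?J" if "\<bar>k\<bar> \<le> ?r" for k
        using elim that by (simp add: le_floor_iff)
      have "real_of_int i < real_of_int ?r" "- real_of_int ?r < real_of_int i"
        using i(1) r far elim(7) by linarith+
      then have ir: "i < ?r" "- ?r < i" by linarith+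
      have right: "\<eta> * real L \<le> real (card {k\<in>?J. i < k})"
      proof -
        have "{i + 1..?r} \<subseteq> {k\<in>?J. i < k}" using ir by (auto intro!: inJ)
        then have "card {i + 1..?r} \<le> card {k\<in>?J. i < k}" using elim by (intro card_mono) auto
        then have "real_of_int (?r - i) \<le> real (card {k\<in>?J. i < k})" using ir by simp
        then show ?thesis using i(1) r far elim(7) by linarith
      qed
      have left: "\<eta> * real L \<le> real (card {k\<in>?J. k \<le> i})"
      proof -
        have "{- ?r..i} \<subseteq> {k\<in>?J. k \<le> i}" using ir by (auto intro!: inJ)
        then have "card {- ?r..i} \<le> card {k\<in>?J. k \<le> i}" using elim by (intro card_mono) auto
        then have "real_of_int (?r + i + 1) \<le> real (card {k\<in>?J. k \<le> i})" using ir by simp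
        then show ?thesis using i(1) r far elim(7) by linarith
      qed
      have "cheeger \<alpha> (real L) (renewal_process (\<lambda>i. Z i \<omega>))
          \<le> (real (m L) * interaction_sum \<alpha>)\<^sup>2 * exp (- (d_exp \<alpha> * \<beta> L powr \<alpha>)) / (\<eta> * real L)"
        by (rule cheeger_upper_bound[where i = i])
           (use \<open>\<forall>i. Z i \<omega> > 0\<close> \<alpha> elim \<beta> i(2) \<eta> L left right in auto)
      also have "\<dots> = C * (real (m L))\<^sup>2 * (exp (- (d_exp \<alpha> * \<beta> L powr \<alpha>)) / real L)"
        by (simp add: C_def power_mult_distrib mult_ac)
      finally show ?case .
    qed
  qed
  then show ?thesis using C by blast
qed

text \<open>A window of \<open>\<theta>\<gamma>L/\<mu>\<close> gaps around the origin stays well inside the box when \<open>\<theta>\<gamma> < 1\<close>; this is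
  where the slack \<open>\<gamma> < 1\<close> is spent.\<close>

lemma large_gap_in_bulk:
  assumes \<gamma>: "\<gamma> \<in> {0<..<1}" and mono: "mono_on {0..} b"
    and lim: "filterlim (\<lambda>n::nat. real n * tail (b (real n))) at_top sequentially"
    and sum: "summable (\<lambda>n::nat. tail (b (real n)) * exp (- (real n * tail (b (real n)))))"
  shows "\<exists>c\<ge>0. c < 1 / (2 * mean_gap) \<and> (AE \<omega> in M. \<forall>\<^sub>F L :: nat in sequentially.
    \<exists>i. \<bar>real_of_int i\<bar> \<le> c * real L \<and> b (\<gamma> * real L / mean_gap) \<le> Z i \<omega>)"
proof -
  obtain \<eta> where \<eta>: "\<gamma> < \<eta>" "\<eta> < 1" using \<gamma> dense[of \<gamma> 1] by auto
  obtain \<eta>' where \<eta>': "\<gamma> < \<eta>'" "\<eta>' < \<eta>" using dense[OF \<eta>(1)] by blast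
  define \<theta> where "\<theta> = \<eta>' / \<gamma>"
  have \<theta>: "\<theta> > 1" "\<theta> * \<gamma> = \<eta>'" using \<gamma> \<eta>' by (auto simp: \<theta>_def field_simps)
  let ?n = "\<lambda>L::nat. nat \<lceil>\<gamma> * real L / mean_gap\<rceil>"
  have n_lim: "filterlim ?n at_top sequentially"
  proof -
    have "filterlim (\<lambda>L::nat. nat \<lceil>q * real L\<rceil>) at_top sequentially" if "q > 0" for q
      using that by real_asymp
    from this[of "\<gamma> / mean_gap"] show ?thesis using \<gamma> mean_gap_pos by simp
  qed
  have "AE \<omega> in M. \<forall>\<^sub>F L :: nat in sequentially.
      \<exists>i. \<bar>real_of_int i\<bar> \<le> \<eta> / (2 * mean_gap) * real L \<and> b (\<gamma> * real L / mean_gap) \<le> Z i \<omega>"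
    using large_gap_eventually[OF lim sum \<theta>(1)]
  proof eventually_elim
    case (elim \<omega>)
    have "\<forall>\<^sub>F L :: nat in sequentially. \<theta> \<le> (\<eta> - \<eta>') / mean_gap * real L"
      using \<eta>' mean_gap_pos by (intro eventually_le_linear) simp
    with eventually_compose_filterlim[OF elim n_lim] show ?case
    proof eventually_elim
      case (elim L)
      then obtain n' i where n': "?n L \<le> n'" "real n' \<le> \<theta> * real (?n L)"
        and i: "2 * \<bar>i\<bar> \<le> int n'" "b (real n') < Z i \<omega>" by blast
      have nonneg: "0 \<le> \<gamma> * real L / mean_gap" using \<gamma> mean_gap_pos by simp
      have ge: "\<gamma> * real L / mean_gap \<le> real (?n L)" by linarith
      have "real (?n L) \<le> \<gamma> * real L / mean_gap + 1" using nonneg by linarith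
      then have "real n' \<le> \<theta> * (\<gamma> * real L / mean_gap + 1)"
        using n'(2) \<theta>(1) by (smt (verit) mult_left_mono)
      also have "\<dots> = \<eta>' * real L / mean_gap + \<theta>" using \<theta>(2) by (simp add: algebra_simps)
      also have "\<dots> \<le> \<eta> / mean_gap * real L" using elim(2) by (simp add: diff_divide_distrib algebra_simps)
      finally have "\<bar>real_of_int i\<bar> \<le> \<eta> / (2 * mean_gap) * real L"
        using i(1) by simp
      moreover have "b (\<gamma> * real L / mean_gap) \<le> b (real n')"
        using ge n'(1) nonneg by (intro mono_onD[OF mono]) auto
      ultimately show ?case using i(2) by (intro exI[of _ i]) auto
    qed
  qed
  moreover have "0 \<le> \<eta> / (2 * mean_gap)" "\<eta> / (2 * mean_gap) < 1 / (2 * mean_gap)"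
    using \<gamma> \<eta> mean_gap_pos by (auto intro!: divide_strict_right_mono)
  ultimately show ?thesis by blast
qed

text \<open>All that the upper bounds need to know about \<open>b\<close>. Besides the admissible functions also \<open>b = 0\<close> has
  this property, which settles the case of a constant \<open>b\<close>: the constant \<open>C\<close> absorbs the exponential.\<close>

definition bulk_gap :: "real \<Rightarrow> (real \<Rightarrow> real) \<Rightarrow> bool" where
  "bulk_gap \<gamma> b \<longleftrightarrow> (\<forall>t\<ge>0. 0 \<le> b t) \<and> (\<exists>c\<ge>0. c < 1 / (2 * mean_gap) \<and> (AE \<omega> in M. \<forall>\<^sub>F L :: nat in sequentially.
    \<exists>i. \<bar>real_of_int i\<bar> \<le> c * real L \<and> b (\<gamma> * real L / mean_gap) \<le> Z i \<omega>))"

lemma bulk_gap_0: "bulk_gap \<gamma> (\<lambda>_. 0)"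
proof -
  have "AE \<omega> in M. \<forall>\<^sub>F L :: nat in sequentially. \<exists>i. \<bar>real_of_int i\<bar> \<le> 0 * real L \<and> 0 \<le> Z i \<omega>"
    using AE_gaps_pos by eventually_elim (auto intro!: always_eventually exI[of _ 0] less_imp_le)
  then show ?thesis
    using mean_gap_pos unfolding bulk_gap_def by (intro conjI exI[of _ 0]) auto
qed

lemma cheeger_eventually_le_log:
  assumes \<alpha>: "0 < \<alpha>" and \<gamma>: "\<gamma> \<in> {0<..<1}" and b: "bulk_gap \<gamma> b"
  shows "\<exists>C>0. AE \<omega> in M. \<forall>\<^sub>F L :: nat in sequentially. cheeger \<alpha> (real L) (renewal_process (\<lambda>i. Z i \<omega>))
    \<le> C * (ln (real L))\<^sup>2 * upper_rate \<alpha> mean_gap \<gamma> b (real L)"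
proof -
  obtain K where K: "K > 0" and spread: "AE \<omega> in M. \<forall>\<^sub>F L in sequentially. \<forall>k. \<bar>real_of_int k\<bar> \<le> 1 / mean_gap * real L \<longrightarrow>
    1 \<le> point \<omega> (k + int (nat \<lceil>K * ln (real L)\<rceil>)) - point \<omega> k"
    using log_clusters[of "1 / mean_gap"] mean_gap_pos by auto
  let ?m = "\<lambda>L::nat. nat \<lceil>K * ln (real L)\<rceil>"
  obtain c where c: "0 \<le> c" "c < 1 / (2 * mean_gap)" and gap: "AE \<omega> in M. \<forall>\<^sub>F L :: nat in sequentially.
    \<exists>i. \<bar>real_of_int i\<bar> \<le> c * real L \<and> b (\<gamma> * real L / mean_gap) \<le> Z i \<omega>"
    using b unfolding bulk_gap_def by blast
  have nonneg: "0 \<le> b (\<gamma> * real L / mean_gap)" for L :: nat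
    using b \<gamma> mean_gap_pos unfolding bulk_gap_def by simp
  have ln_large: "\<forall>\<^sub>F L :: nat in sequentially. 1 \<le> ln (real L)" "\<forall>\<^sub>F L :: nat in sequentially. 1 \<le> K * ln (real L)"
    using K by real_asymp+
  have "\<forall>\<^sub>F L in sequentially. 1 \<le> ?m L"
    using ln_large(2) by eventually_elim linarith
  from cheeger_eventually_le[OF \<alpha> nonneg c gap this spread]
  obtain C where C: "C > 0" and le: "AE \<omega> in M. \<forall>\<^sub>F L :: nat in sequentially.
    cheeger \<alpha> (real L) (renewal_process (\<lambda>i. Z i \<omega>))
    \<le> C * (real (?m L))\<^sup>2 * (exp (- (d_exp \<alpha> * b (\<gamma> * real L / mean_gap) powr \<alpha>)) / real L)" by blast
  from le have "AE \<omega> in M. \<forall>\<^sub>F L :: nat in sequentially. cheeger \<alpha> (real L) (renewal_process (\<lambda>i. Z i \<omega>))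
    \<le> (C * (K + 1)\<^sup>2) * (ln (real L))\<^sup>2 * upper_rate \<alpha> mean_gap \<gamma> b (real L)"
  proof eventually_elim
    case (elim \<omega>)
    from elim ln_large show ?case
    proof eventually_elim
      case (elim L)
      have "real (?m L) \<le> (K + 1) * ln (real L)"
        using elim(2,3) unfolding distrib_right by linarith
      then have "(real (?m L))\<^sup>2 \<le> ((K + 1) * ln (real L))\<^sup>2"
        by (intro power_mono) auto
      then have "C * (real (?m L))\<^sup>2 * upper_rate \<alpha> mean_gap \<gamma> b (real L)
          \<le> C * ((K + 1) * ln (real L))\<^sup>2 * upper_rate \<alpha> mean_gap \<gamma> b (real L)"
        using C by (intro mult_right_mono mult_left_mono) (auto simp: upper_rate_def)
      with elim(1) show ?case by (simp add: upper_rate_def power_mult_distrib mult_ac)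
    qed
  qed
  moreover have "C * (K + 1)\<^sup>2 > 0" using C K by simp
  ultimately show ?thesis by blast
qed

lemma cheeger_eventually_le_no_log:
  assumes \<alpha>: "0 < \<alpha>" and \<gamma>: "\<gamma> \<in> {0<..<1}" and b: "bulk_gap \<gamma> b"
    and \<epsilon>: "\<epsilon> > 0" and away: "\<And>i. AE \<omega> in M. Z i \<omega> > \<epsilon>"
  shows "\<exists>C>0. AE \<omega> in M. \<forall>\<^sub>F L :: nat in sequentially. cheeger \<alpha> (real L) (renewal_process (\<lambda>i. Z i \<omega>))
    \<le> C * upper_rate \<alpha> mean_gap \<gamma> b (real L)"
proof -
  define m where "m = nat \<lceil>1 / \<epsilon>\<rceil>"
  have "1 / \<epsilon> > 0" using \<epsilon> by simp
  then have m: "1 \<le> m" unfolding m_def by linarith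
  obtain c where c: "0 \<le> c" "c < 1 / (2 * mean_gap)" and gap: "AE \<omega> in M. \<forall>\<^sub>F L :: nat in sequentially.
    \<exists>i. \<bar>real_of_int i\<bar> \<le> c * real L \<and> b (\<gamma> * real L / mean_gap) \<le> Z i \<omega>"
    using b unfolding bulk_gap_def by blast
  have nonneg: "0 \<le> b (\<gamma> * real L / mean_gap)" for L :: nat
    using b \<gamma> mean_gap_pos unfolding bulk_gap_def by simp
  have "AE \<omega> in M. \<forall>\<^sub>F L :: nat in sequentially. \<forall>k. \<bar>real_of_int k\<bar> \<le> 1 / mean_gap * real L \<longrightarrow>
      1 \<le> point \<omega> (k + int m) - point \<omega> k"
    using bounded_clusters[OF \<epsilon> away] unfolding m_def by eventually_elim auto
  from cheeger_eventually_le[OF \<alpha> nonneg c gap _ this]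
  obtain C where C: "C > 0" and le: "AE \<omega> in M. \<forall>\<^sub>F L :: nat in sequentially.
    cheeger \<alpha> (real L) (renewal_process (\<lambda>i. Z i \<omega>))
    \<le> C * (real m)\<^sup>2 * (exp (- (d_exp \<alpha> * b (\<gamma> * real L / mean_gap) powr \<alpha>)) / real L)" using m by auto
  then have "AE \<omega> in M. \<forall>\<^sub>F L :: nat in sequentially. cheeger \<alpha> (real L) (renewal_process (\<lambda>i. Z i \<omega>))
    \<le> (C * (real m)\<^sup>2) * upper_rate \<alpha> mean_gap \<gamma> b (real L)"
    by (simp add: upper_rate_def)
  moreover have "C * (real m)\<^sup>2 > 0" using C m by simp
  ultimately show ?thesis by blast
qed

lemma cheeger_eventually_between:
  assumes \<alpha>: "0 < \<alpha>" and \<gamma>: "\<gamma> \<in> {0<..<1}" and mono: "mono_on {0..} a" and nonneg: "\<And>t. 0 \<le> t \<Longrightarrow> 0 \<le> a t"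
    and gaps: "AE \<omega> in M. \<forall>\<^sub>F n in sequentially. \<forall>i. \<bar>i\<bar> \<le> int n \<longrightarrow> Z i \<omega> \<le> a (real n)"
    and b: "bulk_gap \<gamma> b"
  shows "\<exists>C>0. AE \<omega> in M. \<forall>\<^sub>F L :: nat in sequentially.
    1 / C * lower_rate \<alpha> mean_gap \<gamma> a (real L) \<le> cheeger \<alpha> (real L) (renewal_process (\<lambda>i. Z i \<omega>)) \<and>
    cheeger \<alpha> (real L) (renewal_process (\<lambda>i. Z i \<omega>)) \<le> C * (ln (real L))\<^sup>2 * upper_rate \<alpha> mean_gap \<gamma> b (real L)"
proof -
  obtain C1 where C1: "C1 > 0" and lower: "AE \<omega> in M. \<forall>\<^sub>F L :: nat in sequentially.
    1 / C1 * lower_rate \<alpha> mean_gap \<gamma> a (real L) \<le> cheeger \<alpha> (real L) (renewal_process (\<lambda>i. Z i \<omega>))"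
    using cheeger_eventually_ge[OF less_imp_le[OF \<alpha>] \<gamma> mono nonneg gaps] by blast
  obtain C2 where C2: "C2 > 0" and upper: "AE \<omega> in M. \<forall>\<^sub>F L :: nat in sequentially.
    cheeger \<alpha> (real L) (renewal_process (\<lambda>i. Z i \<omega>)) \<le> C2 * (ln (real L))\<^sup>2 * upper_rate \<alpha> mean_gap \<gamma> b (real L)"
    using cheeger_eventually_le_log[OF \<alpha> \<gamma> b] by blast
  let ?C = "max C1 C2"
  have le: "1 / ?C * lower_rate \<alpha> mean_gap \<gamma> a (real L) \<le> 1 / C1 * lower_rate \<alpha> mean_gap \<gamma> a (real L)"
    "C2 * (ln (real L))\<^sup>2 * upper_rate \<alpha> mean_gap \<gamma> b (real L) \<le> ?C * (ln (real L))\<^sup>2 * upper_rate \<alpha> mean_gap \<gamma> b (real L)" for L :: nat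
  proof -
    have "1 / ?C \<le> 1 / C1" using C1 by (intro divide_left_mono) auto
    then show "1 / ?C * lower_rate \<alpha> mean_gap \<gamma> a (real L) \<le> 1 / C1 * lower_rate \<alpha> mean_gap \<gamma> a (real L)"
      by (rule mult_right_mono) (simp add: lower_rate_def)
    show "C2 * (ln (real L))\<^sup>2 * upper_rate \<alpha> mean_gap \<gamma> b (real L) \<le> ?C * (ln (real L))\<^sup>2 * upper_rate \<alpha> mean_gap \<gamma> b (real L)"
      by (intro mult_right_mono) (auto simp: upper_rate_def)
  qed
  have "AE \<omega> in M. \<forall>\<^sub>F L :: nat in sequentially.
    1 / ?C * lower_rate \<alpha> mean_gap \<gamma> a (real L) \<le> cheeger \<alpha> (real L) (renewal_process (\<lambda>i. Z i \<omega>)) \<and>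
    cheeger \<alpha> (real L) (renewal_process (\<lambda>i. Z i \<omega>)) \<le> ?C * (ln (real L))\<^sup>2 * upper_rate \<alpha> mean_gap \<gamma> b (real L)"
    using lower upper
  proof eventually_elim
    case (elim \<omega>)
    then show ?case
    proof eventually_elim
      case (elim L)
      show ?case using order.trans[OF le(1) elim(1)] order.trans[OF elim(2) le(2)] by blast
    qed
  qed
  then show ?thesis using C1 by (intro exI[of _ ?C]) auto
qed

lemma AE_all_gaps:
  assumes "\<forall>i. \<P>(\<omega> in M. P (Z i \<omega>)) = 1" and [measurable]: "Measurable.pred borel P"
  shows "AE \<omega> in M. P (Z i \<omega>)"
  using assms(1)[rule_format, of i] by (subst (asm) prob_Collect_eq_1) auto

end

theorem theorem1p4:
  fixes M :: "'s measure" and Z :: "int \<Rightarrow> 's \<Rightarrow> real"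
    and \<alpha> \<mu> :: real and \<psi> :: "real \<Rightarrow> real" and \<Phi> :: "nat \<Rightarrow> 's \<Rightarrow> real"
  assumes alpha: "\<alpha> > 0"
    and prob: "prob_space M"
    and indep: "prob_space.indep_vars M (\<lambda>_. borel) Z UNIV"
    and ident: "\<And>i. distr M borel (Z i) = distr M borel (Z 0)"
    and pos: "\<And>i. AE \<omega> in M. Z i \<omega> > 0"
    and integ: "integrable M (Z 0)"
    and mu: "\<mu> = prob_space.expectation M (Z 0)"
    and psi: "\<And>t. \<psi> t = \<P>(\<omega> in M. Z 0 \<omega> > t)"
    and Phi: "\<And>L \<omega>. \<Phi> L \<omega> = cheeger \<alpha> (real L) (renewal_process (\<lambda>i. Z i \<omega>))"
  shows
    "(\<forall>a b. admissible \<psi> a b \<longrightarrow>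
       (\<forall>\<gamma>\<in>{0<..<1}. \<exists>C>0. AE \<omega> in M. \<exists>L0. \<forall>L::nat\<ge>L0.
          1 / C * lower_rate \<alpha> \<mu> \<gamma> a (real L) \<le> \<Phi> L \<omega> \<and>
          \<Phi> L \<omega> \<le> C * (ln (real L))\<^sup>2 * upper_rate \<alpha> \<mu> \<gamma> b (real L)))
   \<and> ((\<exists>K. \<forall>i. \<P>(\<omega> in M. Z i \<omega> \<le> K) = 1) \<longrightarrow>
       (\<exists>a0\<ge>0. \<exists>b0\<ge>0. \<forall>\<gamma>\<in>{0<..<1}. \<exists>C>0. AE \<omega> in M. \<exists>L0. \<forall>L::nat\<ge>L0.
          1 / C * lower_rate \<alpha> \<mu> \<gamma> (\<lambda>_. a0) (real L) \<le> \<Phi> L \<omega> \<and>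
          \<Phi> L \<omega> \<le> C * (ln (real L))\<^sup>2 * upper_rate \<alpha> \<mu> \<gamma> (\<lambda>_. b0) (real L)))
   \<and> ((\<exists>\<epsilon>>0. \<forall>i. \<P>(\<omega> in M. Z i \<omega> > \<epsilon>) = 1) \<longrightarrow>
       (\<forall>a b. admissible \<psi> a b \<longrightarrow>
         (\<forall>\<gamma>\<in>{0<..<1}. \<exists>C>0. AE \<omega> in M. \<exists>L0. \<forall>L::nat\<ge>L0.
            \<Phi> L \<omega> \<le> C * upper_rate \<alpha> \<mu> \<gamma> b (real L)))
     \<and> ((\<exists>K. \<forall>i. \<P>(\<omega> in M. Z i \<omega> \<le> K) = 1) \<longrightarrow>
         (\<exists>b0\<ge>0. \<forall>\<gamma>\<in>{0<..<1}. \<exists>C>0. AE \<omega> in M. \<exists>L0. \<forall>L::nat\<ge>L0.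
            \<Phi> L \<omega> \<le> C * upper_rate \<alpha> \<mu> \<gamma> (\<lambda>_. b0) (real L))))"
proof -
  interpret renewal_gaps M Z
    using prob indep ident pos integ by (intro renewal_gaps.intro renewal_gaps_axioms.intro)
  have \<mu>: "mean_gap = \<mu>" unfolding mean_gap_def mu ..
  have \<psi>: "tail = \<psi>" by (rule ext) (simp add: tail_def psi)
  note ev = eventually_sequentially[symmetric]
  have bulk: "bulk_gap \<gamma> b" if adm: "admissible \<psi> a b" and \<gamma>: "\<gamma> \<in> {0<..<1}" for a b \<gamma>
    unfolding bulk_gap_def
  proof
    show "\<forall>t\<ge>0. 0 \<le> b t" using adm by (simp add: admissible_def)
    have "mono_on {0..} b" "filterlim (\<lambda>n::nat. real n * tail (b (real n))) at_top sequentially"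
      "summable (\<lambda>n::nat. tail (b (real n)) * exp (- (real n * tail (b (real n)))))"
      using adm unfolding admissible_def \<psi> by simp_all
    then show "\<exists>c\<ge>0. c < 1 / (2 * mean_gap) \<and> (AE \<omega> in M. \<forall>\<^sub>F L :: nat in sequentially.
        \<exists>i. \<bar>real_of_int i\<bar> \<le> c * real L \<and> b (\<gamma> * real L / mean_gap) \<le> Z i \<omega>)"
      by (rule large_gap_in_bulk[OF \<gamma>])
  qed
  have no_log: "\<exists>C>0. AE \<omega> in M. \<exists>L0. \<forall>L::nat\<ge>L0. \<Phi> L \<omega> \<le> C * upper_rate \<alpha> \<mu> \<gamma> b (real L)"
    if "\<epsilon> > 0" "\<forall>i. \<P>(\<omega> in M. Z i \<omega> > \<epsilon>) = 1" "\<gamma> \<in> {0<..<1}" "bulk_gap \<gamma> b" for \<epsilon> \<gamma> b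
    unfolding ev Phi
    using cheeger_eventually_le_no_log[OF alpha that(3,4,1) AE_all_gaps[OF that(2)]] unfolding \<mu> by simp
  show ?thesis
  proof (intro conjI impI allI ballI)
    fix a b \<gamma> assume adm: "admissible \<psi> a b" and \<gamma>: "\<gamma> \<in> {0<..<1::real}"
    have "AE \<omega> in M. \<forall>\<^sub>F n in sequentially. \<forall>i. \<bar>i\<bar> \<le> int n \<longrightarrow> Z i \<omega> \<le> a (real n)"
      using adm by (intro gaps_eventually_le) (auto simp: admissible_def \<psi>)
    from cheeger_eventually_between[OF alpha \<gamma> _ _ this bulk[OF adm \<gamma>]] adm
    show "\<exists>C>0. AE \<omega> in M. \<exists>L0. \<forall>L::nat\<ge>L0.
          1 / C * lower_rate \<alpha> \<mu> \<gamma> a (real L) \<le> \<Phi> L \<omega> \<and>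
          \<Phi> L \<omega> \<le> C * (ln (real L))\<^sup>2 * upper_rate \<alpha> \<mu> \<gamma> b (real L)"
      unfolding ev Phi \<mu> by (simp add: admissible_def)
  next
    assume "\<exists>K. \<forall>i. \<P>(\<omega> in M. Z i \<omega> \<le> K) = 1"
    then obtain K where K: "\<forall>i. \<P>(\<omega> in M. Z i \<omega> \<le> K) = 1" by blast
    have "AE \<omega> in M. \<forall>i. Z i \<omega> \<le> K"
      using AE_all_gaps[OF K] by (simp add: AE_all_countable)
    then have "AE \<omega> in M. \<forall>\<^sub>F n :: nat in sequentially. \<forall>i. \<bar>i\<bar> \<le> int n \<longrightarrow> Z i \<omega> \<le> max K 0"
      by eventually_elim (simp add: le_max_iff_disj)
    from cheeger_eventually_between[OF alpha _ _ _ this bulk_gap_0]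
    have "\<forall>\<gamma>\<in>{0<..<1}. \<exists>C>0. AE \<omega> in M. \<exists>L0. \<forall>L::nat\<ge>L0.
          1 / C * lower_rate \<alpha> \<mu> \<gamma> (\<lambda>_. max K 0) (real L) \<le> \<Phi> L \<omega> \<and>
          \<Phi> L \<omega> \<le> C * (ln (real L))\<^sup>2 * upper_rate \<alpha> \<mu> \<gamma> (\<lambda>_. 0) (real L)"
      unfolding ev Phi \<mu> by (simp add: mono_on_const)
    then show "\<exists>a0\<ge>0. \<exists>b0\<ge>0. \<forall>\<gamma>\<in>{0<..<1}. \<exists>C>0. AE \<omega> in M. \<exists>L0. \<forall>L::nat\<ge>L0.
          1 / C * lower_rate \<alpha> \<mu> \<gamma> (\<lambda>_. a0) (real L) \<le> \<Phi> L \<omega> \<and>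
          \<Phi> L \<omega> \<le> C * (ln (real L))\<^sup>2 * upper_rate \<alpha> \<mu> \<gamma> (\<lambda>_. b0) (real L)"
      by (intro exI[of _ "max K 0"] exI[of _ 0] conjI) auto
  next
    fix a b \<gamma> assume "\<exists>\<epsilon>>0. \<forall>i. \<P>(\<omega> in M. Z i \<omega> > \<epsilon>) = 1"
      and "admissible \<psi> a b" "\<gamma> \<in> {0<..<1::real}"
    then show "\<exists>C>0. AE \<omega> in M. \<exists>L0. \<forall>L::nat\<ge>L0. \<Phi> L \<omega> \<le> C * upper_rate \<alpha> \<mu> \<gamma> b (real L)"
      using no_log bulk by blast
  next
    assume "\<exists>\<epsilon>>0. \<forall>i. \<P>(\<omega> in M. Z i \<omega> > \<epsilon>) = 1"
    then show "\<exists>b0\<ge>0. \<forall>\<gamma>\<in>{0<..<1}. \<exists>C>0. AE \<omega> in M. \<exists>L0. \<forall>L::nat\<ge>L0.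
            \<Phi> L \<omega> \<le> C * upper_rate \<alpha> \<mu> \<gamma> (\<lambda>_. b0) (real L)"
      using no_log bulk_gap_0 by (intro exI[of _ 0]) blast
  qed
qed

end
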